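(* Let $n\ge 2$ be an integer, $a,b\in\mathbb{R}\setminus\{-n\}$ and $p,q>1$. Assume that $$\frac1p+\frac1q<1\qquad\text{and}\qquad \frac{a+n}{p}+\frac{b+n}{q}=n-2 .$$ Then the system $$-\Delta u=|x|^a|v|^{p-2}v,\qquad -\Delta v=|x|^{b}|u|^{q-2}u\qquad\text{on }\mathbb{R}^n\setminus\{0\}$$ has a nontrivial radially symmetric solution $u,v$ with $$u\in \mathcal{D}^{2,p'}_{\rm r}\big(\mathbb{R}^n;|x|^{-\frac{a}{p-1}}\,dx\big),\qquad v\in \mathcal{D}^{2,q'}_{\rm r}\big(\mathbb{R}^n;|x|^{-\frac{b}{q-1}}\,dx\big).$$ In addition, $u,v$ satisfies $$\lim_{|x|\to \infty}|x|^{\frac{b+n}{q}} u(x)=\lim_{x\to 0}|x|^{\frac{b+n}{q}} u(x)=\lim_{|x|\to \infty}|x|^{\frac{a+n}{p}}v(x)=\lim_{x\to 0}|x|^{\frac{a+n}{p}}v(x)=0 .$$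
   Context: Here $p'=\frac{p}{p-1}$ and $q'=\frac{q}{q-1}$. A radially symmetric solution is a pair of radial functions $u,v\in C^2(\mathbb{R}^n\setminus\{0\})$ satisfying both equations pointwise on $\mathbb{R}^n\setminus\{0\}$; nontrivial means $(u,v)\not\equiv(0,0)$. The expression $|t|^{r-2}t$ with $r>1$ is understood to be $0$ at $t=0$. For $\theta\in(1,\infty)$ and $\alpha\in\mathbb{R}$ with $\alpha\notin\{2\theta-n,\ n\theta-n\}$, the Banach space $\mathcal{D}^{2,\theta}_{\rm r}(\mathbb{R}^n;|x|^\alpha dx)$ is the completion of the set of radial functions in $C^2_c(\mathbb{R}^n\setminus\{0\})$ with respect to the norm $\|u\|_\alpha=\left(\int_{\mathbb{R}^n}|x|^\alpha|\Delta u|^\theta\,dx\right)^{1/\theta}$. For such $\alpha$ this norm controls the norm of $L^\theta(\mathbb{R}^n;|x|^{\alpha-2\theta}dx)$ on radial functions in $C^2_c(\mathbb{R}^n\setminus\{0\})$, and the completion is identified with a space of radial functions: its elements are the limits in $L^\theta(\mathbb{R}^n;|x|^{\alpha-2\theta}dx)$ of $\|\cdot\|_\alpha$-Cauchy sequences of radial functions in $C^2_c(\mathbb{R}^n\setminus\{0\})$. *)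

theory Defs
  imports "HOL-Analysis.Analysis"
begin

definition partial_deriv :: "'a \<Rightarrow> ('a::euclidean_space \<Rightarrow> real) \<Rightarrow> 'a \<Rightarrow> real" where
  "partial_deriv i u x = deriv (\<lambda>t. u (x + t *\<^sub>R i)) 0"

definition laplacian :: "('a::euclidean_space \<Rightarrow> real) \<Rightarrow> 'a \<Rightarrow> real" where
  "laplacian u x = (\<Sum>i\<in>Basis. partial_deriv i (partial_deriv i u) x)"

text \<open>Meant for open sets \<open>S\<close>: all partial derivatives up to order \<open>k\<close> exist and are
  continuous on \<open>S\<close>. The values of \<open>u\<close> outside \<open>S\<close> are irrelevant.\<close>

primrec Ck_on :: "nat \<Rightarrow> 'a set \<Rightarrow> ('a::euclidean_space \<Rightarrow> real) \<Rightarrow> bool" where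
  "Ck_on 0 S u \<longleftrightarrow> continuous_on S u"
| "Ck_on (Suc k) S u \<longleftrightarrow> continuous_on S u \<and>
     (\<forall>i\<in>Basis. (\<forall>x\<in>S. (\<lambda>t. u (x + t *\<^sub>R i)) field_differentiable at 0) \<and>
                Ck_on k S (partial_deriv i u))"

definition radial :: "('a::euclidean_space \<Rightarrow> real) \<Rightarrow> bool" where
  "radial u \<longleftrightarrow> (\<forall>x y. norm x = norm y \<longrightarrow> u x = u y)"

text \<open>Radial functions in \<open>C\<^sup>2\<^sub>c\<close> of the punctured space, extended by \<open>0\<close> to the origin.\<close>

definition radial_C2c :: "('a::euclidean_space \<Rightarrow> real) set" where
  "radial_C2c = {u. radial u \<and> Ck_on 2 (- {0}) u \<and>
     compact (closure {x. u x \<noteq> 0}) \<and> 0 \<notin> closure {x. u x \<noteq> 0}}"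

text \<open>The space of \<open>\<theta>\<close>-integrable functions for the measure \<open>|x|\<^sup>\<beta> dx\<close>, without passing to
  classes modulo null sets, and its norm (meaningful on members only).\<close>

definition weighted_L :: "real \<Rightarrow> real \<Rightarrow> ('a::euclidean_space \<Rightarrow> real) set" where
  "weighted_L \<theta> \<beta> = {f. f \<in> borel_measurable lebesgue \<and>
     integrable lebesgue (\<lambda>x. norm x powr \<beta> * \<bar>f x\<bar> powr \<theta>)}"

definition weighted_norm :: "real \<Rightarrow> real \<Rightarrow> ('a::euclidean_space \<Rightarrow> real) \<Rightarrow> real" where
  "weighted_norm \<theta> \<beta> f =
     (LINT x|lebesgue. norm x powr \<beta> * \<bar>f x\<bar> powr \<theta>) powr (1 / \<theta>)"

definition D2_norm :: "real \<Rightarrow> real \<Rightarrow> ('a::euclidean_space \<Rightarrow> real) \<Rightarrow> real" where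
  "D2_norm \<theta> \<alpha> u = weighted_norm \<theta> \<alpha> (laplacian u)"

text \<open>The completion of \<^const>\<open>radial_C2c\<close> under \<^const>\<open>D2_norm\<close>, realised inside
  \<open>L\<^sup>\<theta>(|x|\<^sup>\<alpha>\<^sup>-\<^sup>2\<^sup>\<theta> dx)\<close>; to be used for \<open>\<theta> > 1\<close> and \<open>\<alpha> \<notin> {2\<theta> - n, n\<theta> - n}\<close>, where \<open>n\<close> is the
  dimension. Members are representatives, hence radial only up to a null set.\<close>

definition D2_rad :: "real \<Rightarrow> real \<Rightarrow> ('a::euclidean_space \<Rightarrow> real) set" where
  "D2_rad \<theta> \<alpha> = {u \<in> weighted_L \<theta> (\<alpha> - 2 * \<theta>).
     \<exists>\<phi> :: nat \<Rightarrow> 'a \<Rightarrow> real. (\<forall>k. \<phi> k \<in> radial_C2c) \<and>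
       (\<forall>\<epsilon>>0. \<exists>N. \<forall>j\<ge>N. \<forall>k\<ge>N. D2_norm \<theta> \<alpha> (\<lambda>x. \<phi> j x - \<phi> k x) < \<epsilon>) \<and>
       (\<lambda>k. weighted_norm \<theta> (\<alpha> - 2 * \<theta>) (\<lambda>x. \<phi> k x - u x)) \<longlonglongrightarrow> 0}"

text \<open>The values of \<open>u\<close> and \<open>v\<close> at the origin play no role. Since \<open>0 powr s = 0\<close> for every \<open>s\<close>,
  the nonlinearities vanish where \<open>v\<close>, respectively \<open>u\<close>, does, also for exponents below \<open>2\<close>.\<close>

definition radial_solution ::
  "real \<Rightarrow> real \<Rightarrow> real \<Rightarrow> real \<Rightarrow> ('a::euclidean_space \<Rightarrow> real) \<Rightarrow> ('a \<Rightarrow> real) \<Rightarrow> bool" where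
  "radial_solution a b p q u v \<longleftrightarrow>
     radial u \<and> radial v \<and> Ck_on 2 (- {0}) u \<and> Ck_on 2 (- {0}) v \<and>
     (\<forall>x. x \<noteq> 0 \<longrightarrow>
        - laplacian u x = norm x powr a * (\<bar>v x\<bar> powr (p - 2) * v x) \<and>
        - laplacian v x = norm x powr b * (\<bar>u x\<bar> powr (q - 2) * u x))"

end

theory Submission
  imports Defs "HOL-Complex_Analysis.Great_Picard"
begin

text \<open>
  Put \<open>c = (b + n)/q\<close> and \<open>d = (a + n)/p\<close>, so that \<open>c, d \<noteq> 0\<close> and \<open>c + d = n - 2\<close>. The
  Emden-Fowler substitution \<open>u = \<sigma> \<bar>x\<bar>\<^sup>-\<^sup>c f(ln \<bar>x\<bar>)\<close>, \<open>v = \<bar>x\<bar>\<^sup>-\<^sup>d g(ln \<bar>x\<bar>)\<close> with \<open>\<sigma> = sgn (c d)\<close> turns the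
  system for nonnegative \<open>f\<close>, \<open>g\<close> into an autonomous one on the line,
  \<open>- (D - c)(D + d) f = \<sigma> g\<^sup>p\<^sup>-\<^sup>1\<close> and \<open>- (D - d)(D + c) g = \<sigma> f\<^sup>q\<^sup>-\<^sup>1\<close>, where \<open>D = d/dt\<close>. As \<open>c\<close> and \<open>d\<close> do not
  vanish, the operators are inverted by convolution with one-sided exponentials, one for each first
  order factor, and the sign \<open>\<sigma>\<close> makes the inverse \<open>T\<close> of the first one positive. The system becomes
  \<open>f = T (g\<^sup>p\<^sup>-\<^sup>1)\<close>, \<open>g = T* (f\<^sup>q\<^sup>-\<^sup>1)\<close> with the adjoint \<open>T*\<close>.

  It is solved by maximising \<open>\<integral> (T h)\<^sup>q\<close> over \<open>h \<ge> 0\<close> with \<open>\<integral> h\<^sup>s \<le> 1\<close>, where \<open>s = p/(p - 1)\<close>. The hypothesis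
  \<open>1/p + 1/q < 1\<close> means \<open>s < q\<close>, and this prevents a maximising sequence from spreading out: after
  translations the values of \<open>T h\<close> at \<open>0\<close> stay above a positive constant. Instead of a maximiser the proof uses near
  maximisers. Replacing \<open>h\<close> by the multiple of \<open>(T* (T h)\<^sup>q\<^sup>-\<^sup>1)\<^sup>p\<^sup>-\<^sup>1\<close> of norm \<open>1\<close> does not decrease the functional, and the
  integrated deficit in Young's inequality between the old and the new \<open>T h\<close> is at most a multiple of the
  distance to the supremum (\<open>improve_step\<close>). The functions \<open>T h\<close> are uniformly Lipschitz, so
  they converge pointwise along a subsequence, and in the limit the deficit vanishes, which is the
  equation up to a constant (\<open>exists_scaled_fixed_point\<close>); superlinearity allows to scale the constant away
  (\<open>exists_fixed_point\<close>).

  Jensen's inequality for the kernels gives \<open>f, f', f'' \<in> L\<^sup>s\<close>, the analogue for \<open>g\<close> with \<open>q/(q - 1)\<close>, and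
  the decay of \<open>f\<close> and \<open>g\<close> at both ends, which is the asymptotic statement. In logarithmic coordinates
  the weighted norms are multiples of unweighted norms of the profiles, so that cutting off \<open>f\<close> and \<open>g\<close>
  approximates \<open>u\<close> and \<open>v\<close> in the required spaces (\<open>D2_rad_emden_fowler\<close>).
\<close>

section \<open>Convolution with one-sided exponentials\<close>

text \<open>For \<open>m \<noteq> 0\<close>, the kernel \<open>e\<^sup>-\<^sup>m\<^sup>t\<close> on the half-line on which it decays: the causal one if
  \<open>m > 0\<close>, the anticausal one if \<open>m < 0\<close>. Multiplied by \<open>sgn m\<close> it is the bounded
  fundamental solution of \<open>d/dt + m\<close>. Both signs are needed, and changing the sign of \<open>m\<close> reflects the kernel,
  so that \<open>exp_conv (- m)\<close> below is the adjoint of \<open>exp_conv m\<close>.\<close>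

definition exp_kernel :: "real \<Rightarrow> real \<Rightarrow> real" where
  "exp_kernel m t = (if 0 \<le> m * t then exp (- m * t) else 0)"

text \<open>The convolution of \<open>h\<close> with \<^const>\<open>exp_kernel\<close>: for bounded continuous \<open>h\<close> it is the bounded
  solution \<open>w\<close> of \<open>w' + m w = sgn m h\<close>.\<close>

definition exp_conv :: "real \<Rightarrow> (real \<Rightarrow> real) \<Rightarrow> real \<Rightarrow> real" where
  "exp_conv m h t = (\<integral>y. exp_kernel m y * h (t - y) \<partial>lborel)"

text \<open>Bounded continuous nonnegative functions on the line. The integral operators
  below preserve this class, and their defining integrals converge on it.\<close>

definition nonneg_Cb :: "(real \<Rightarrow> real) \<Rightarrow> bool" where
  "nonneg_Cb h \<longleftrightarrow> continuous_on UNIV h \<and> (\<forall>t. 0 \<le> h t) \<and> (\<exists>B. \<forall>t. h t \<le> B)"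

lemma exp_kernel_measurable [measurable]: "exp_kernel m \<in> borel_measurable borel"
  unfolding exp_kernel_def[abs_def] by measurable

lemma exp_kernel_nonneg [simp]: "0 \<le> exp_kernel m t"
  by (simp add: exp_kernel_def)

lemma exp_kernel_le_1: "exp_kernel m t \<le> 1"
  by (simp add: exp_kernel_def)

lemma exp_kernel_minus: "exp_kernel (- m) (- t) = exp_kernel m t"
  by (simp add: exp_kernel_def)

lemma nonneg_Cb_nonneg: "nonneg_Cb h \<Longrightarrow> 0 \<le> h t"
  by (simp add: nonneg_Cb_def)

lemma nonneg_Cb_measurable: "nonneg_Cb h \<Longrightarrow> h \<in> borel_measurable borel"
  by (simp add: nonneg_Cb_def borel_measurable_continuous_onI)

lemma nonneg_Cb_powr: assumes "nonneg_Cb h" "0 < r" shows "nonneg_Cb (\<lambda>t. h t powr r)"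
proof -
  obtain B where B: "\<And>t. h t \<le> B" using assms(1) by (auto simp: nonneg_Cb_def)
  have "h t powr r \<le> B powr r" for t
    using B[of t] assms by (intro powr_mono2) (auto simp: nonneg_Cb_def)
  moreover have "continuous_on UNIV (\<lambda>t. h t powr r)"
    using assms by (intro continuous_on_powr' continuous_on_const) (auto simp: nonneg_Cb_def)
  ultimately show ?thesis by (auto simp: nonneg_Cb_def)
qed

lemma nonneg_Cb_cmult: assumes "nonneg_Cb h" "0 \<le> c" shows "nonneg_Cb (\<lambda>t. c * h t)"
proof -
  obtain B where B: "\<And>t. h t \<le> B" using assms(1) by (auto simp: nonneg_Cb_def)
  have "c * h t \<le> c * B" for t using B assms by (simp add: mult_left_mono)
  then show ?thesis using assms by (auto simp: nonneg_Cb_def intro!: continuous_intros)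
qed

lemma nonneg_Cb_shift: assumes "nonneg_Cb h" shows "nonneg_Cb (\<lambda>t. h (t + c))"
  using assms by (auto simp: nonneg_Cb_def intro!: continuous_on_compose2[of UNIV h] continuous_intros)

lemma nonneg_Cb_reflect: assumes "nonneg_Cb h" shows "nonneg_Cb (\<lambda>t. h (- t))"
  using assms by (auto simp: nonneg_Cb_def intro!: continuous_on_compose2[of UNIV h] continuous_intros)

lemma lborel_integral_uminus: "(\<integral>y. f (- y) \<partial>lborel) = (\<integral>y. f y \<partial>lborel)" for f :: "real \<Rightarrow> real"
  using lborel_integral_real_affine[of "-1" f 0] by simp

lemma nn_integral_exp_kernel:
  assumes "m \<noteq> 0" shows "(\<integral>\<^sup>+y. ennreal (exp_kernel m y) \<partial>lborel) = ennreal (1 / \<bar>m\<bar>)"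
proof -
  have *: "(\<integral>\<^sup>+y. ennreal (exp_kernel m y) \<partial>lborel) = ennreal (1 / m)" if "m > 0" for m
  proof -
    have "(\<integral>\<^sup>+y. ennreal (exp_kernel m y) \<partial>lborel)
        = (\<integral>\<^sup>+y. ennreal (exp (- m * y)) * indicator {0..} y \<partial>lborel)"
      using that by (intro nn_integral_cong) (auto simp: exp_kernel_def indicator_def zero_le_mult_iff)
    also have "\<dots> = ennreal (0 - (- exp (- m * 0) / m))"
    proof (rule nn_integral_FTC_atLeast)
      show "((\<lambda>y. - exp (- m * y) / m) has_real_derivative exp (- m * x)) (at x)" for x
        using that by (auto intro!: derivative_eq_intros)
      have "((\<lambda>y. exp (- m * y)) \<longlongrightarrow> 0) at_top"
        using that by (intro filterlim_compose[OF exp_at_bot] filterlim_tendsto_neg_mult_at_bot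
          [OF tendsto_const]) (auto simp: filterlim_ident)
      then have "((\<lambda>y. - exp (- m * y) / m) \<longlongrightarrow> - 0 / m) at_top"
        using that by (intro tendsto_divide tendsto_minus tendsto_const) auto
      then show "((\<lambda>y. - exp (- m * y) / m) \<longlongrightarrow> 0) at_top" by simp
    qed auto
    finally show ?thesis by simp
  qed
  show ?thesis
  proof (cases "m > 0")
    case True then show ?thesis using * by simp
  next
    case False
    have "(\<integral>\<^sup>+y. ennreal (exp_kernel m y) \<partial>lborel) = (\<integral>\<^sup>+y. ennreal (exp_kernel m (- y)) \<partial>lborel)"
      using nn_integral_real_affine[of "\<lambda>y. ennreal (exp_kernel m y)" "-1" 0] by simp
    also have "\<dots> = (\<integral>\<^sup>+y. ennreal (exp_kernel (- m) y) \<partial>lborel)"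
      using exp_kernel_minus[of "-m"] by simp
    finally show ?thesis using *[of "-m"] False assms by simp
  qed
qed

lemma integrable_exp_kernel: "m \<noteq> 0 \<Longrightarrow> integrable lborel (exp_kernel m)"
  using nn_integral_exp_kernel[of m] by (intro integrableI_nonneg) auto

lemma integral_exp_kernel: "m \<noteq> 0 \<Longrightarrow> (\<integral>y. exp_kernel m y \<partial>lborel) = 1 / \<bar>m\<bar>"
  using nn_integral_exp_kernel[of m] by (subst integral_eq_nn_integral) auto

lemma integrable_exp_conv:
  assumes "m \<noteq> 0" "nonneg_Cb h"
  shows "integrable lborel (\<lambda>y. exp_kernel m y * h (t - y))"
proof -
  obtain B where B: "\<And>t. h t \<le> B" using assms(2) by (auto simp: nonneg_Cb_def)
  note [measurable] = nonneg_Cb_measurable[OF assms(2)]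
  show ?thesis
  proof (rule Bochner_Integration.integrable_bound)
    show "integrable lborel (\<lambda>y. exp_kernel m y * B)"
      using integrable_exp_kernel[OF assms(1)] by simp
    show "AE y in lborel. norm (exp_kernel m y * h (t - y)) \<le> norm (exp_kernel m y * B)"
      using B nonneg_Cb_nonneg[OF assms(2)] order_trans[OF nonneg_Cb_nonneg[OF assms(2)] B]
      by (auto simp: abs_mult intro!: mult_left_mono)
  qed measurable
qed

lemma exp_conv_nonneg: "nonneg_Cb h \<Longrightarrow> 0 \<le> exp_conv m h t"
  unfolding exp_conv_def by (intro integral_nonneg_AE) (auto simp: nonneg_Cb_def)

lemma exp_conv_le:
  assumes "m \<noteq> 0" "nonneg_Cb h" "\<And>t. h t \<le> B"
  shows "exp_conv m h t \<le> B / \<bar>m\<bar>"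
proof -
  have "exp_conv m h t \<le> (\<integral>y. exp_kernel m y * B \<partial>lborel)"
    unfolding exp_conv_def using assms integrable_exp_kernel[OF assms(1)] integrable_exp_conv[OF assms(1,2)]
    by (intro integral_mono mult_left_mono) auto
  then show ?thesis using integral_exp_kernel[OF assms(1)] by simp
qed

lemma exp_conv_shift: "exp_conv m (\<lambda>t. h (t + c)) t = exp_conv m h (t + c)"
  unfolding exp_conv_def by (simp add: algebra_simps)

lemma exp_conv_cmult: "exp_conv m (\<lambda>t. c * h t) t = c * exp_conv m h t"
  unfolding exp_conv_def by (simp add: mult.left_commute)

lemma exp_conv_reflect: "exp_conv m h t = exp_conv (- m) (\<lambda>t. h (- t)) (- t)"
  unfolding exp_conv_def
  using lborel_integral_uminus[of "\<lambda>y. exp_kernel m y * h (t - y)"] exp_kernel_minus[of "-m"]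
  by (simp add: add.commute)

lemma exp_conv_alt: "exp_conv m h t = (\<integral>y. exp_kernel m (t - y) * h y \<partial>lborel)"
  unfolding exp_conv_def
  using lborel_integral_real_affine[of "-1" "\<lambda>y. exp_kernel m y * h (t - y)" t] by simp

lemma integrable_exp_conv_alt:
  assumes "m \<noteq> 0" "nonneg_Cb h"
  shows "integrable lborel (\<lambda>y. exp_kernel m (t - y) * h y)"
  using lborel_integrable_real_affine[OF integrable_exp_conv[OF assms, of t], of "-1" t] by simp

text \<open>The causal case; the other one follows by reflection. Factoring \<open>e\<^sup>-\<^sup>m\<^sup>t\<close> out of the convolution
  leaves an indefinite integral from \<open>-\<infinity>\<close>, whose increments are integrals over compact intervals.\<close>

lemma exp_conv_DERIV_pos:
  assumes m: "m > 0" and h: "nonneg_Cb h"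
  shows "(exp_conv m h has_real_derivative h t - m * exp_conv m h t) (at t)"
proof -
  define k where "k y = exp (m * y) * h y" for y
  define G where "G t = (LINT y:{..t}|lborel. k y)" for t
  have k_cont: "continuous_on A k" for A
    unfolding k_def using h
    by (auto simp: nonneg_Cb_def intro!: continuous_intros intro: continuous_on_subset)
  have ker: "exp_kernel m (t - y) * h y = exp (- m * t) * (indicator {..t} y *\<^sub>R k y)" for t y
    using m by (auto simp: exp_kernel_def k_def indicator_def zero_le_mult_iff algebra_simps exp_diff exp_minus
         field_simps)
  have int: "set_integrable lborel {..t} k" for t
    using integrable_exp_conv_alt[of m h t] m h unfolding ker set_integrable_def by simp
  have S: "exp_conv m h t = exp (- m * t) * G t" for t
    unfolding exp_conv_alt ker G_def set_lebesgue_integral_def by simp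
  have G: "G s = G (t - 1) + integral {t-1..s} k" if "s \<in> {t-1..t+1}" for s
  proof -
    have "{..s} = {..t-1} \<union> {t-1<..s}" using that by auto
    then have "G s = G (t - 1) + (LINT y:{t-1<..s}|lborel. k y)"
      unfolding G_def by (simp only:) (intro set_integral_Un set_integrable_subset[OF int[of s]]; use that in auto)
    also have "(LINT y:{t-1<..s}|lborel. k y) = integral {t-1<..s} k"
      by (intro set_borel_integral_eq_integral set_integrable_subset[OF int[of s]]) auto
    also have "\<dots> = integral {t-1..s} k"
      by (rule integral_spike_set) (auto intro: negligible_subset[of "{t-1}"])
    finally show ?thesis .
  qed
  have "((\<lambda>s. G (t - 1) + integral {t-1..s} k) has_real_derivative 0 + k t) (at t within {t-1..t+1})"
    by (intro DERIV_add DERIV_const integral_has_real_derivative k_cont) auto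
  then have "(G has_real_derivative k t) (at t within {t-1..t+1})"
    unfolding add_0_left
    by (rule has_field_derivative_transform_within[OF _ zero_less_one]) (simp, rule G[symmetric])
  then have "(G has_real_derivative k t) (at t)"
    using at_within_Icc_at[of "t-1" t "t+1"] by simp
  then have "((\<lambda>t. exp (- m * t) * G t) has_real_derivative
       (exp (- m * t) * k t - m * (exp (- m * t) * G t))) (at t)"
    by (auto intro!: derivative_eq_intros)
  moreover have "exp (- m * t) * k t = h t"
    by (simp add: k_def exp_minus field_simps)
  ultimately show ?thesis unfolding S by simp
qed

lemma exp_conv_DERIV:
  assumes m: "m \<noteq> 0" and h: "nonneg_Cb h"
  shows "(exp_conv m h has_real_derivative sgn m * h t - m * exp_conv m h t) (at t)"
proof (cases "m > 0")
  case True then show ?thesis using exp_conv_DERIV_pos h by simp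
next
  case False
  let ?k = "\<lambda>t. h (- t)"
  have "exp_conv m h = (\<lambda>t. exp_conv (- m) ?k (- t))"
    by (rule ext) (rule exp_conv_reflect)
  moreover have "((\<lambda>t. exp_conv (- m) ?k (- t)) has_real_derivative
      (?k (- t) - (- m) * exp_conv (- m) ?k (- t)) * (-1)) (at t)"
    using False m h
    by (intro DERIV_chain2[OF exp_conv_DERIV_pos] nonneg_Cb_reflect) (auto intro!: derivative_eq_intros)
  ultimately show ?thesis using False m by (simp add: algebra_simps)
qed

lemma exp_conv_nonneg_Cb:
  assumes "m \<noteq> 0" "nonneg_Cb h" shows "nonneg_Cb (exp_conv m h)"
proof -
  obtain B where "\<And>t. h t \<le> B" using assms(2) by (auto simp: nonneg_Cb_def)
  then have "\<exists>B. \<forall>t. exp_conv m h t \<le> B" using exp_conv_le[OF assms] by blast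
  moreover have "continuous_on UNIV (exp_conv m h)"
    using exp_conv_DERIV[OF assms] by (meson DERIV_isCont continuous_at_imp_continuous_on)
  ultimately show ?thesis using exp_conv_nonneg[OF assms(2)] by (auto simp: nonneg_Cb_def)
qed

lemma ennreal_exp_conv:
  assumes "m \<noteq> 0" "nonneg_Cb h"
  shows "ennreal (exp_conv m h t) = (\<integral>\<^sup>+y. ennreal (exp_kernel m (t - y) * h y) \<partial>lborel)"
  unfolding exp_conv_alt
  using integrable_exp_conv_alt[OF assms] nonneg_Cb_nonneg[OF assms(2)]
  by (intro nn_integral_eq_integral[symmetric]) auto

text \<open>Tonelli's theorem and the symmetry of the kernel under reflection.\<close>

lemma exp_conv_duality_nn:
  assumes m: "m \<noteq> 0" and F: "nonneg_Cb F" and h: "nonneg_Cb h"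
  shows "(\<integral>\<^sup>+t. ennreal (F t * exp_conv m h t) \<partial>lborel) =
         (\<integral>\<^sup>+t. ennreal (exp_conv (- m) F t * h t) \<partial>lborel)"
proof -
  note [measurable] = nonneg_Cb_measurable[OF F] nonneg_Cb_measurable[OF h]
  note nn = nonneg_Cb_nonneg[OF F] nonneg_Cb_nonneg[OF h]
  have "(\<integral>\<^sup>+t. ennreal (F t * exp_conv m h t) \<partial>lborel) =
      (\<integral>\<^sup>+t. (\<integral>\<^sup>+y. ennreal (F t * (exp_kernel m (t - y) * h y)) \<partial>lborel) \<partial>lborel)"
    using nn by (intro nn_integral_cong)
      (simp add: ennreal_mult exp_conv_nonneg[OF h] ennreal_exp_conv[OF m h] nn_integral_cmult)
  also have "\<dots> = (\<integral>\<^sup>+y. (\<integral>\<^sup>+t. ennreal (F t * (exp_kernel m (t - y) * h y)) \<partial>lborel) \<partial>lborel)"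
    by (rule lborel_pair.Fubini') measurable
  also have "\<dots> = (\<integral>\<^sup>+t. ennreal (exp_conv (- m) F t * h t) \<partial>lborel)"
  proof (rule nn_integral_cong)
    fix y
    have "exp_kernel m (t - y) = exp_kernel (- m) (y - t)" for t
      using exp_kernel_minus[of m "t - y"] by simp
    then have "(\<integral>\<^sup>+t. ennreal (F t * (exp_kernel m (t - y) * h y)) \<partial>lborel) =
      (\<integral>\<^sup>+t. ennreal (exp_kernel (- m) (y - t) * F t) * ennreal (h y) \<partial>lborel)"
      using nn by (simp add: ennreal_mult mult_ac)
    then show "(\<integral>\<^sup>+t. ennreal (F t * (exp_kernel m (t - y) * h y)) \<partial>lborel) = ennreal (exp_conv (- m) F y * h y)"
      using m nn F by (simp add: nn_integral_multc ennreal_mult ennreal_exp_conv exp_conv_nonneg)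
  qed
  finally show ?thesis .
qed

lemma integrable_nn_transfer:
  fixes f g :: "real \<Rightarrow> real"
  assumes "(\<integral>\<^sup>+t. ennreal (f t) \<partial>lborel) = (\<integral>\<^sup>+t. ennreal (g t) \<partial>lborel)"
    and "f \<in> borel_measurable borel" "g \<in> borel_measurable borel" "\<And>t. 0 \<le> f t" "\<And>t. 0 \<le> g t"
    and "integrable lborel g"
  shows "integrable lborel f" "(\<integral>t. f t \<partial>lborel) = (\<integral>t. g t \<partial>lborel)"
proof -
  show "integrable lborel f"
    using assms by (intro integrableI_nonneg) (auto simp: nn_integral_eq_integral)
  show "(\<integral>t. f t \<partial>lborel) = (\<integral>t. g t \<partial>lborel)"
    using assms by (simp add: integral_eq_nn_integral)
qed

lemma exp_conv_duality:
  assumes m: "m \<noteq> 0" and F: "nonneg_Cb F" and h: "nonneg_Cb h"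
    and int: "integrable lborel (\<lambda>t. exp_conv (- m) F t * h t)"
  shows "integrable lborel (\<lambda>t. F t * exp_conv m h t)"
    "(\<integral>t. F t * exp_conv m h t \<partial>lborel) = (\<integral>t. exp_conv (- m) F t * h t \<partial>lborel)"
proof -
  have b: "nonneg_Cb (exp_conv (- m) F)" "nonneg_Cb (exp_conv m h)"
    using m F h by (auto intro!: exp_conv_nonneg_Cb)
  note [measurable] = nonneg_Cb_measurable[OF F] nonneg_Cb_measurable[OF h] b[THEN nonneg_Cb_measurable]
  note nn = nonneg_Cb_nonneg[OF F] nonneg_Cb_nonneg[OF h] b[THEN nonneg_Cb_nonneg]
  note * = integrable_nn_transfer[OF exp_conv_duality_nn[OF m F h] _ _ _ _ int]
  show "integrable lborel (\<lambda>t. F t * exp_conv m h t)"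
    "(\<integral>t. F t * exp_conv m h t \<partial>lborel) = (\<integral>t. exp_conv (- m) F t * h t \<partial>lborel)"
    by (rule *; use nn in simp)+
qed

lemma exp_conv_one: "m \<noteq> 0 \<Longrightarrow> exp_conv m (\<lambda>_. 1) t = 1 / \<bar>m\<bar>"
  by (simp add: exp_conv_def integral_exp_kernel)

lemma exp_conv_integral:
  assumes m: "m \<noteq> 0" and h: "nonneg_Cb h" and int: "integrable lborel h"
  shows "integrable lborel (exp_conv m h)"
    "(\<integral>t. exp_conv m h t \<partial>lborel) = (\<integral>t. h t \<partial>lborel) / \<bar>m\<bar>"
  using exp_conv_duality[OF m _ h, of "\<lambda>_. 1"] m int
  by (auto simp: exp_conv_one nonneg_Cb_def)

text \<open>The graph of a power lies above its tangent at \<open>l\<close>.\<close>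

lemma powr_tangent:
  fixes x l :: real
  assumes r: "1 < r" and "0 \<le> x" "0 \<le> l"
  shows "l powr r + r * l powr (r - 1) * (x - l) \<le> x powr r"
proof (cases "l = 0")
  case True then show ?thesis using assms by simp
next
  case False
  with assms have l: "l > 0" by simp
  have "x * l powr (r - 1) \<le> x powr r / r + (l powr (r - 1)) powr (r / (r - 1)) / (r / (r - 1))"
    using assms by (intro Youngs_inequality) (auto simp: field_simps)
  also have "(l powr (r - 1)) powr (r / (r - 1)) = l powr r"
    using r by (simp add: powr_powr)
  finally have "r * (x * l powr (r - 1)) \<le> x powr r + l powr r * (r - 1)"
    using r by (simp add: field_simps)
  moreover have "l powr (r - 1) * l = l powr r"
    using l by (simp add: powr_diff)
  ultimately show ?thesis by (simp add: algebra_simps)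
qed

text \<open>Jensen's inequality for the kernel, which has mass \<open>1 / \<bar>m\<bar>\<close>.\<close>

lemma exp_conv_jensen:
  assumes m: "m \<noteq> 0" and h: "nonneg_Cb h" and r: "1 < r"
  shows "exp_conv m h t powr r \<le> \<bar>m\<bar> powr (1 - r) * exp_conv m (\<lambda>t. h t powr r) t"
proof -
  \<comment> \<open>the kernel average of \<open>h\<close> around \<open>t\<close>; integrate the tangent inequality at this point\<close>
  define l where "l = \<bar>m\<bar> * exp_conv m h t"
  have l: "0 \<le> l" using exp_conv_nonneg[OF h] by (simp add: l_def)
  have hr: "nonneg_Cb (\<lambda>t. h t powr r)" using h r by (intro nonneg_Cb_powr) auto
  have S: "exp_conv m h t = l / \<bar>m\<bar>" using m by (simp add: l_def)
  have e: "(\<lambda>y. exp_kernel m y * (l powr r + r * l powr (r - 1) * (h (t - y) - l))) =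
     (\<lambda>y. (l powr r - r * l powr (r - 1) * l) * exp_kernel m y + r * l powr (r - 1) * (exp_kernel m y * h (t - y)))"
    by (auto simp: algebra_simps)
  have i: "integrable lborel (\<lambda>y. exp_kernel m y * (l powr r + r * l powr (r - 1) * (h (t - y) - l)))"
    unfolding e using integrable_exp_conv[OF m h, of t] integrable_exp_kernel[OF m] by simp
  have "(\<integral>y. exp_kernel m y * (l powr r + r * l powr (r - 1) * (h (t - y) - l)) \<partial>lborel)
      \<le> exp_conv m (\<lambda>t. h t powr r) t"
    unfolding exp_conv_def using integrable_exp_conv[OF m hr] nonneg_Cb_nonneg[OF h] r l
    by (intro integral_mono i mult_left_mono powr_tangent) auto
  also have "(\<integral>y. exp_kernel m y * (l powr r + r * l powr (r - 1) * (h (t - y) - l)) \<partial>lborel)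
     = (l powr r - r * l powr (r - 1) * l) / \<bar>m\<bar> + r * l powr (r - 1) * exp_conv m h t"
    unfolding e exp_conv_def using integrable_exp_conv[OF m h, of t] integrable_exp_kernel[OF m]
    by (simp add: integral_exp_kernel m)
  also have "\<dots> = l powr r / \<bar>m\<bar>"
    unfolding S using m by (simp add: field_simps)
  finally have *: "l powr r / \<bar>m\<bar> \<le> exp_conv m (\<lambda>t. h t powr r) t" .
  have "exp_conv m h t powr r = \<bar>m\<bar> powr (1 - r) * (l powr r / \<bar>m\<bar>)"
    unfolding S using m l by (simp add: powr_divide powr_diff)
  also have "\<dots> \<le> \<bar>m\<bar> powr (1 - r) * exp_conv m (\<lambda>t. h t powr r) t"
    by (intro mult_left_mono *) auto
  finally show ?thesis .
qed

lemma exp_conv_Lr: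
  assumes m: "m \<noteq> 0" and h: "nonneg_Cb h" and r: "1 < r" and int: "integrable lborel (\<lambda>t. h t powr r)"
  shows "integrable lborel (\<lambda>t. exp_conv m h t powr r)"
    "(\<integral>t. exp_conv m h t powr r \<partial>lborel) \<le> \<bar>m\<bar> powr (- r) * (\<integral>t. h t powr r \<partial>lborel)"
proof -
  have hr: "nonneg_Cb (\<lambda>t. h t powr r)" using h r by (intro nonneg_Cb_powr) auto
  note I = exp_conv_integral[OF m hr int]
  have i: "integrable lborel (\<lambda>t. \<bar>m\<bar> powr (1 - r) * exp_conv m (\<lambda>t. h t powr r) t)"
    using I by simp
  note [measurable] = nonneg_Cb_measurable[OF exp_conv_nonneg_Cb[OF m h]]
  show i2: "integrable lborel (\<lambda>t. exp_conv m h t powr r)"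
    by (rule Bochner_Integration.integrable_bound[OF i])
       (use exp_conv_jensen[OF m h r] exp_conv_nonneg[OF hr] in \<open>auto simp: abs_mult\<close>)
  have "(\<integral>t. exp_conv m h t powr r \<partial>lborel) \<le> (\<integral>t. \<bar>m\<bar> powr (1 - r) * exp_conv m (\<lambda>t. h t powr r) t \<partial>lborel)"
    by (intro integral_mono i i2 exp_conv_jensen m h r)
  also have "\<dots> = \<bar>m\<bar> powr (- r) * (\<integral>t. h t powr r \<partial>lborel)"
    using m by (simp add: I(2) powr_diff powr_minus field_simps)
  finally show "(\<integral>t. exp_conv m h t powr r \<partial>lborel) \<le> \<bar>m\<bar> powr (- r) * (\<integral>t. h t powr r \<partial>lborel)" .
qed

text \<open>The kernel is at most \<open>1\<close> and \<open>h \<le> 1 + h\<^sup>r\<close>, so an \<open>L\<^sup>r\<close> bound on \<open>h\<close> gives a sup bound on its convolution.\<close>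

lemma exp_conv_le_Lr:
  assumes m: "m \<noteq> 0" and h: "nonneg_Cb h" and r: "1 < r" and int: "integrable lborel (\<lambda>t. h t powr r)"
  shows "exp_conv m h t \<le> 1 / \<bar>m\<bar> + (\<integral>t. h t powr r \<partial>lborel)"
proof -
  have i: "integrable lborel (\<lambda>y. h (t - y) powr r)"
    using lborel_integrable_real_affine[OF int, of "-1" t] by simp
  have "exp_conv m h t \<le> (\<integral>y. exp_kernel m y + h (t - y) powr r \<partial>lborel)"
    unfolding exp_conv_def
  proof (intro integral_mono integrable_exp_conv[OF m h] Bochner_Integration.integrable_add integrable_exp_kernel i m)
    fix y
    have "h (t - y) \<le> 1 + h (t - y) powr r"
    proof (cases "h (t - y) \<le> 1")
      case False
      then have "h (t - y) powr 1 \<le> h (t - y) powr r" using r by (intro powr_mono) auto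
      then show ?thesis using False by simp
    qed (simp add: add_increasing2)
    then have "exp_kernel m y * h (t - y) \<le> exp_kernel m y * (1 + h (t - y) powr r)"
      by (intro mult_left_mono) auto
    also have "\<dots> \<le> exp_kernel m y + h (t - y) powr r"
      using mult_right_mono[OF exp_kernel_le_1[of m y], of "h (t - y) powr r"] by (simp add: algebra_simps)
    finally show "exp_kernel m y * h (t - y) \<le> exp_kernel m y + h (t - y) powr r" .
  qed
  also have "\<dots> = 1 / \<bar>m\<bar> + (\<integral>y. h (t - y) powr r \<partial>lborel)"
    using i integrable_exp_kernel[OF m] integral_exp_kernel[OF m] by simp
  also have "(\<integral>y. h (t - y) powr r \<partial>lborel) = (\<integral>y. h y powr r \<partial>lborel)"
    using lborel_integral_real_affine[of "-1" "\<lambda>y. h y powr r" t] by simp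
  finally show ?thesis .
qed

lemma exp_conv_tendsto:
  assumes m: "m \<noteq> 0" and F: "\<And>k. nonneg_Cb (F k)" and G: "\<And>t. (\<lambda>k. F k t) \<longlonglongrightarrow> G t"
    and B: "\<And>k t. F k t \<le> B"
  shows "(\<lambda>k. exp_conv m (F k) t) \<longlonglongrightarrow> exp_conv m G t"
  unfolding exp_conv_def
proof (rule integral_dominated_convergence[where w = "\<lambda>y. exp_kernel m y * B"])
  note [measurable] = nonneg_Cb_measurable[OF F]
  have [measurable]: "G \<in> borel_measurable borel"
    by (rule borel_measurable_LIMSEQ_real[OF G]) auto
  show "(\<lambda>y. exp_kernel m y * G (t - y)) \<in> borel_measurable lborel" by measurable
  show "\<And>i. (\<lambda>y. exp_kernel m y * F i (t - y)) \<in> borel_measurable lborel" by measurable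
  show "integrable lborel (\<lambda>y. exp_kernel m y * B)" using integrable_exp_kernel[OF m] by simp
  show "AE y in lborel. (\<lambda>i. exp_kernel m y * F i (t - y)) \<longlonglongrightarrow> exp_kernel m y * G (t - y)"
    by (intro AE_I2 tendsto_intros G)
  show "\<And>i. AE y in lborel. norm (exp_kernel m y * F i (t - y)) \<le> exp_kernel m y * B"
    using B nonneg_Cb_nonneg[OF F] by (auto simp: abs_mult intro!: mult_left_mono)
qed

lemma exp_kernel_at_top: assumes "m \<noteq> 0" shows "((\<lambda>t. exp_kernel m (t - y)) \<longlongrightarrow> 0) at_top"
proof (cases "m > 0")
  case True
  have "((\<lambda>t. exp (m * y) * exp (- m * t)) \<longlongrightarrow> exp (m * y) * 0) at_top"
    using True by (intro tendsto_mult tendsto_const filterlim_compose[OF exp_at_bot]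
       filterlim_tendsto_neg_mult_at_bot[OF tendsto_const]) (auto simp: filterlim_ident)
  moreover have "\<forall>\<^sub>F t in at_top. exp (m * y) * exp (- m * t) = exp_kernel m (t - y)"
    using eventually_ge_at_top[of y]
    by eventually_elim (use True in \<open>auto simp: exp_kernel_def zero_le_mult_iff algebra_simps exp_diff exp_minus field_simps\<close>)
  ultimately show ?thesis by (auto intro: Lim_transform_eventually)
next
  case False
  then have "\<forall>\<^sub>F t in at_top. 0 = exp_kernel m (t - y)"
    by (intro eventually_mono[OF eventually_gt_at_top[of y]])
       (use False assms in \<open>auto simp: exp_kernel_def zero_le_mult_iff\<close>)
  then show ?thesis by (auto intro: Lim_transform_eventually)
qed

text \<open>By Jensen's inequality the \<open>r\<close>-th power of the convolution is dominated by the convolution of the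
  integrable function \<open>h\<^sup>r\<close>, which vanishes at infinity by dominated convergence.\<close>

lemma exp_conv_decay_top:
  assumes m: "m \<noteq> 0" and h: "nonneg_Cb h" and r: "1 < r" and int: "integrable lborel (\<lambda>t. h t powr r)"
  shows "(exp_conv m h \<longlongrightarrow> 0) at_top"
proof -
  have hr: "nonneg_Cb (\<lambda>t. h t powr r)" using h r by (intro nonneg_Cb_powr) auto
  note [measurable] = nonneg_Cb_measurable[OF hr]
  have "((\<lambda>t. \<integral>y. exp_kernel m (t - y) * h y powr r \<partial>lborel) \<longlongrightarrow> (\<integral>y. 0 * h y powr r \<partial>lborel)) at_top"
  proof (rule integral_dominated_convergence_at_top[where w = "\<lambda>y. h y powr r"])
    show "AE y in lborel. ((\<lambda>t. exp_kernel m (t - y) * h y powr r) \<longlongrightarrow> 0 * h y powr r) at_top"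
      by (intro AE_I2 tendsto_mult tendsto_const exp_kernel_at_top m)
    show "\<forall>\<^sub>F t in at_top. AE y in lborel. norm (exp_kernel m (t - y) * h y powr r) \<le> h y powr r"
      by (intro always_eventually allI AE_I2) (simp add: abs_mult mult_left_le_one_le exp_kernel_le_1)
  qed (use int in measurable)
  then have "((\<lambda>t. exp_conv m (\<lambda>t. h t powr r) t) \<longlongrightarrow> 0) at_top"
    unfolding exp_conv_alt by simp
  then have lim: "((\<lambda>t. \<bar>m\<bar> powr (1 - r) * exp_conv m (\<lambda>t. h t powr r) t) \<longlongrightarrow> 0) at_top"
    by (rule tendsto_mult_right_zero)
  have "((\<lambda>t. exp_conv m h t powr r) \<longlongrightarrow> 0) at_top"
  proof (rule Lim_null_comparison[OF _ lim], rule always_eventually, rule allI)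
    fix t show "norm (exp_conv m h t powr r) \<le> \<bar>m\<bar> powr (1 - r) * exp_conv m (\<lambda>t. h t powr r) t"
      using exp_conv_jensen[OF m h r, of t] by (simp only: real_norm_def abs_of_nonneg[OF powr_ge_zero])
  qed
  then have "((\<lambda>t. (exp_conv m h t powr r) powr (1 / r)) \<longlongrightarrow> 0 powr (1 / r)) at_top"
    by (rule tendsto_powr'[OF _ tendsto_const]) (use r in auto)
  moreover have "(exp_conv m h t powr r) powr (1 / r) = exp_conv m h t" for t
    using r exp_conv_nonneg[OF h] by (simp add: powr_powr)
  ultimately show ?thesis by (simp only: powr_0)
qed

lemma exp_conv_decay_bot:
  assumes m: "m \<noteq> 0" and h: "nonneg_Cb h" and r: "1 < r" and int: "integrable lborel (\<lambda>t. h t powr r)"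
  shows "(exp_conv m h \<longlongrightarrow> 0) at_bot"
proof -
  have "(exp_conv (- m) (\<lambda>t. h (- t)) \<longlongrightarrow> 0) at_top"
    using m h r lborel_integrable_real_affine[OF int, of "-1" 0]
    by (intro exp_conv_decay_top nonneg_Cb_reflect) auto
  then show ?thesis
    by (subst filterlim_at_bot_mirror) (simp add: exp_conv_reflect[of m h])
qed

section \<open>Positivity and compactness on the line\<close>

lemma powr_tangent_strict:
  fixes x l :: real
  assumes r: "1 < r" and x: "0 \<le> x" and l: "0 \<le> l" and ne: "x \<noteq> l"
  shows "l powr r + r * l powr (r - 1) * (x - l) < x powr r"
proof -
  \<comment> \<open>add the tangent inequalities at \<open>l\<close> and at the midpoint; the slope there differs strictly from that at \<open>l\<close>\<close>
  define z where "z = (x + l) / 2"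
  have z: "0 \<le> z" "x - z = (x - l) / 2" "z - l = (x - l) / 2" using x l by (auto simp: z_def field_simps)
  have 1: "l powr r + r * l powr (r - 1) * ((x - l) / 2) \<le> z powr r"
    using powr_tangent[OF r z(1) l] z by simp
  have 2: "z powr r + r * z powr (r - 1) * ((x - l) / 2) \<le> x powr r"
    using powr_tangent[OF r x z(1)] z by simp
  have "0 < (z powr (r - 1) - l powr (r - 1)) * (x - l)"
  proof (cases "x < l")
    case True
    then have "z powr (r - 1) < l powr (r - 1)"
      using z(1) r by (intro powr_less_mono2) (auto simp: z_def)
    then show ?thesis using True by (intro mult_neg_neg) auto
  next
    case False
    then have "l powr (r - 1) < z powr (r - 1)"
      using l r ne by (intro powr_less_mono2) (auto simp: z_def)
    then show ?thesis using False ne by (intro mult_pos_pos) auto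
  qed
  then have "0 < r / 2 * ((z powr (r - 1) - l powr (r - 1)) * (x - l))"
    using r by (subst zero_less_mult_iff) simp
  then show ?thesis using 1 2 by (simp add: algebra_simps) argo
qed

lemma exp_conv_pos:
  assumes m: "m \<noteq> 0" and h: "nonneg_Cb h" and pos: "\<And>t. 0 < h t"
  shows "0 < exp_conv m h t"
proof (rule ccontr)
  assume "\<not> 0 < exp_conv m h t"
  then have "(\<integral>y. exp_kernel m y * h (t - y) \<partial>lborel) = 0"
    using exp_conv_nonneg[OF h, of m t] by (simp add: exp_conv_def)
  then have "AE y in lborel. exp_kernel m y * h (t - y) = 0"
    using integrable_exp_conv[OF m h, of t] pos
    by (subst (asm) integral_nonneg_eq_0_iff_AE) (auto simp: less_imp_le)
  then have "AE y in lborel. exp_kernel m y = 0"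
    using pos by (auto elim!: eventually_mono simp: less_le)
  then have "(\<integral>y. exp_kernel m y \<partial>lborel) = 0"
    by (simp add: integral_eq_zero_AE)
  then show False using integral_exp_kernel[OF m] m by simp
qed

section \<open>Second order operators with a kernel factored into exponentials\<close>

text \<open>The composition of two convolutions, which inverts \<open>(d/dt + n)(d/dt + m)\<close> up to a sign. The
  adjoint is \<open>exp_conv2 (- n) (- m)\<close>.\<close>

definition exp_conv2 :: "real \<Rightarrow> real \<Rightarrow> (real \<Rightarrow> real) \<Rightarrow> real \<Rightarrow> real" where
  "exp_conv2 m n h = exp_conv m (exp_conv n h)"

lemma exp_conv2_nonneg_Cb: "m \<noteq> 0 \<Longrightarrow> n \<noteq> 0 \<Longrightarrow> nonneg_Cb h \<Longrightarrow> nonneg_Cb (exp_conv2 m n h)"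
  by (simp add: exp_conv2_def exp_conv_nonneg_Cb)

lemma exp_conv2_le:
  assumes "m \<noteq> 0" "n \<noteq> 0" "nonneg_Cb h" "\<And>t. h t \<le> B"
  shows "exp_conv2 m n h t \<le> B / \<bar>n\<bar> / \<bar>m\<bar>"
  unfolding exp_conv2_def using assms by (intro exp_conv_le exp_conv_nonneg_Cb)

lemma exp_conv2_shift: "exp_conv2 m n (\<lambda>t. h (t + c)) t = exp_conv2 m n h (t + c)"
  unfolding exp_conv2_def exp_conv_shift ..

lemma exp_conv2_cmult: "exp_conv2 m n (\<lambda>t. c * h t) t = c * exp_conv2 m n h t"
  unfolding exp_conv2_def exp_conv_cmult ..

lemma exp_conv2_duality:
  assumes "m \<noteq> 0" "n \<noteq> 0" "nonneg_Cb F" "nonneg_Cb h"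
    and int: "integrable lborel (\<lambda>t. exp_conv2 (- n) (- m) F t * h t)"
  shows "integrable lborel (\<lambda>t. F t * exp_conv2 m n h t)"
    "(\<integral>t. F t * exp_conv2 m n h t \<partial>lborel) = (\<integral>t. exp_conv2 (- n) (- m) F t * h t \<partial>lborel)"
proof -
  note b = exp_conv_nonneg_Cb[of "- m" F] exp_conv_nonneg_Cb[of n h]
  note 1 = exp_conv_duality[of n "exp_conv (- m) F" h]
  note 2 = exp_conv_duality[of m F "exp_conv n h"]
  show "integrable lborel (\<lambda>t. F t * exp_conv2 m n h t)"
    "(\<integral>t. F t * exp_conv2 m n h t \<partial>lborel) = (\<integral>t. exp_conv2 (- n) (- m) F t * h t \<partial>lborel)"
    using assms b 1 2 by (auto simp: exp_conv2_def)
qed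

lemma exp_conv2_Lr:
  assumes "m \<noteq> 0" "n \<noteq> 0" "nonneg_Cb h" "1 < r" "integrable lborel (\<lambda>t. h t powr r)"
  shows "integrable lborel (\<lambda>t. exp_conv2 m n h t powr r)"
    "(\<integral>t. exp_conv2 m n h t powr r \<partial>lborel) \<le> \<bar>m\<bar> powr (- r) * \<bar>n\<bar> powr (- r) * (\<integral>t. h t powr r \<partial>lborel)"
proof -
  note 1 = exp_conv_Lr[OF assms(2-5)]
  note 2 = exp_conv_Lr[OF assms(1) exp_conv_nonneg_Cb[OF assms(2,3)] assms(4) 1(1)]
  show "integrable lborel (\<lambda>t. exp_conv2 m n h t powr r)" using 2(1) by (simp add: exp_conv2_def)
  have "(\<integral>t. exp_conv2 m n h t powr r \<partial>lborel) \<le> \<bar>m\<bar> powr (- r) * (\<integral>t. exp_conv n h t powr r \<partial>lborel)"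
    using 2(2) by (simp add: exp_conv2_def)
  also have "\<dots> \<le> \<bar>m\<bar> powr (- r) * (\<bar>n\<bar> powr (- r) * (\<integral>t. h t powr r \<partial>lborel))"
    by (intro mult_left_mono 1(2)) auto
  finally show "(\<integral>t. exp_conv2 m n h t powr r \<partial>lborel) \<le> \<bar>m\<bar> powr (- r) * \<bar>n\<bar> powr (- r) * (\<integral>t. h t powr r \<partial>lborel)"
    by (simp add: mult.assoc)
qed

lemma exp_conv2_tendsto:
  assumes m: "m \<noteq> 0" "n \<noteq> 0" and F: "\<And>k. nonneg_Cb (F k)" and G: "\<And>t. (\<lambda>k. F k t) \<longlonglongrightarrow> G t"
    and B: "\<And>k t. F k t \<le> B"
  shows "(\<lambda>k. exp_conv2 m n (F k) t) \<longlonglongrightarrow> exp_conv2 m n G t"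
  unfolding exp_conv2_def
  by (rule exp_conv_tendsto[where B = "B / \<bar>n\<bar>"])
     (use assms in \<open>auto intro!: exp_conv_nonneg_Cb exp_conv_tendsto exp_conv_le\<close>)

lemma mvt_Lipschitz:
  fixes f :: "real \<Rightarrow> real"
  assumes d: "\<And>t. (f has_real_derivative f' t) (at t)" and b: "\<And>t. \<bar>f' t\<bar> \<le> C"
  shows "\<bar>f x - f y\<bar> \<le> C * \<bar>x - y\<bar>"
  using field_differentiable_bound[of UNIV f f' C x y] d b by auto

lemma continuous_AE_eq:
  fixes f g :: "real \<Rightarrow> real"
  assumes "continuous_on UNIV f" "continuous_on UNIV g" "AE t in lborel. f t = g t"
  shows "f t = g t"
proof (rule ccontr)
  assume ne: "f t \<noteq> g t"
  have op: "open {t. f t \<noteq> g t}"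
    using assms by (intro open_Collect_neq)
  have "AE t in lebesgue. f t = g t" using assms(3) by (rule AE_completion)
  then have "negligible {t. f t \<noteq> g t}"
    by (simp add: eventually_ae_filter_negligible) (metis (mono_tags, lifting) mem_Collect_eq negligible_subset subsetI)
  then show False using open_not_negligible[OF op] ne by blast
qed

lemma integrable_powr_mono_exponent:
  assumes f: "nonneg_Cb f" and "0 < r" "r \<le> r'" and int: "integrable lborel (\<lambda>t. f t powr r)"
    and B: "\<And>t. f t \<le> B"
  shows "integrable lborel (\<lambda>t. f t powr r')"
    "(\<integral>t. f t powr r' \<partial>lborel) \<le> B powr (r' - r) * (\<integral>t. f t powr r \<partial>lborel)"
proof -
  note [measurable] = nonneg_Cb_measurable[OF f]
  have le: "f t powr r' \<le> B powr (r' - r) * f t powr r" for t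
  proof -
    have "f t powr r' = f t powr (r' - r) * f t powr r" by (simp add: powr_add[symmetric])
    also have "\<dots> \<le> B powr (r' - r) * f t powr r"
      using assms nonneg_Cb_nonneg[OF f] by (intro mult_right_mono powr_mono2) auto
    finally show ?thesis .
  qed
  have i: "integrable lborel (\<lambda>t. B powr (r' - r) * f t powr r)" using int by simp
  show i': "integrable lborel (\<lambda>t. f t powr r')"
    by (rule Bochner_Integration.integrable_bound[OF i]) (use le in auto)
  have "(\<integral>t. f t powr r' \<partial>lborel) \<le> (\<integral>t. B powr (r' - r) * f t powr r \<partial>lborel)"
    by (intro integral_mono i i' le)
  then show "(\<integral>t. f t powr r' \<partial>lborel) \<le> B powr (r' - r) * (\<integral>t. f t powr r \<partial>lborel)" by simp
qed

text \<open>Uniformly bounded and uniformly Lipschitz functions: a diagonal subsequence converges on the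
  rationals, and the Lipschitz bound carries convergence over to all points.\<close>

lemma pointwise_convergent_subsequence:
  fixes f :: "nat \<Rightarrow> real \<Rightarrow> real"
  assumes L: "\<And>k x y. \<bar>f k x - f k y\<bar> \<le> C * \<bar>x - y\<bar>" and B: "\<And>k x. \<bar>f k x\<bar> \<le> B" and C: "0 < C"
  obtains r where "strict_mono r" "\<And>x. convergent (\<lambda>k. f (r k) x)"
proof -
  obtain r where r: "strict_mono (r :: nat \<Rightarrow> nat)" "\<And>x. x \<in> \<rat> \<Longrightarrow> \<exists>l. (\<lambda>n. f (r n) x) \<longlonglongrightarrow> l"
    using function_convergent_subsequence[of "\<rat>" f B] B countable_rat by auto
  have "Cauchy (\<lambda>k. f (r k) x)" for x
  proof (rule metric_CauchyI)
    fix e :: real assume e: "0 < e"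
    have "x < x + e / (3 * C)" using e C by simp
    then obtain y where y: "y \<in> \<rat>" "x < y" "y < x + e / (3 * C)" using Rats_dense_in_real by blast
    have "C * \<bar>x - y\<bar> < C * (e / (3 * C))" using y C by (intro mult_strict_left_mono) auto
    then have yC: "C * \<bar>x - y\<bar> < e / 3" using C by simp
    have "Cauchy (\<lambda>k. f (r k) y)" using r(2)[OF y(1)] by (auto intro: LIMSEQ_imp_Cauchy)
    then obtain N where N: "\<And>i j. i \<ge> N \<Longrightarrow> j \<ge> N \<Longrightarrow> dist (f (r i) y) (f (r j) y) < e / 3"
      using e by (metis metric_CauchyD zero_less_divide_iff zero_less_numeral)
    show "\<exists>M. \<forall>i\<ge>M. \<forall>j\<ge>M. dist (f (r i) x) (f (r j) x) < e"
    proof (intro exI allI impI)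
      fix i j assume "i \<ge> N" "j \<ge> N"
      then show "dist (f (r i) x) (f (r j) x) < e"
        using N[of i j] L[of "r i" x y] L[of "r j" x y] yC unfolding dist_real_def by linarith
    qed
  qed
  then show thesis using that r(1) real_Cauchy_convergent by blast
qed

section \<open>A positive solution of the integral system on the line\<close>

text \<open>For \<open>T = exp_conv2 m n\<close> with adjoint \<open>T*\<close>, this part solves \<open>f = T (g\<^sup>p\<^sup>-\<^sup>1)\<close>,
  \<open>g = T* (f\<^sup>q\<^sup>-\<^sup>1)\<close>. The last assumption says that \<open>1/p + 1/q < 1\<close>.\<close>

locale conv_pair =
  fixes m n p q :: real
  assumes m: "m \<noteq> 0" and n: "n \<noteq> 0" and p: "1 < p" and q: "1 < q" and superlinear: "1 < (p - 1) * (q - 1)"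
begin

text \<open>The exponent conjugate to \<open>p\<close>.\<close>

definition s :: real where "s = p / (p - 1)"

text \<open>The admissible functions of the variational problem: the nonnegative part of the unit ball of \<open>L\<^sup>s\<close>,
  restricted to bounded continuous functions.\<close>

definition unit_class :: "(real \<Rightarrow> real) set" where
  "unit_class = {h. nonneg_Cb h \<and> integrable lborel (\<lambda>t. h t powr s) \<and> (\<integral>t. h t powr s \<partial>lborel) \<le> 1}"

text \<open>The functional to be maximised over \<^const>\<open>unit_class\<close>.\<close>

definition Q :: "(real \<Rightarrow> real) \<Rightarrow> real" where
  "Q h = (\<integral>t. exp_conv2 m n h t powr q \<partial>lborel)"

lemma s: "1 < s" "s < q" "(p - 1) * s = p" "1 / p + 1 / s = 1"
  using p q superlinear by (auto simp: s_def field_simps)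

lemma m': "- m \<noteq> 0" and n': "- n \<noteq> 0" using m n by auto

lemma unit_classD:
  assumes "h \<in> unit_class"
  shows "nonneg_Cb h" "integrable lborel (\<lambda>t. h t powr s)" "(\<integral>t. h t powr s \<partial>lborel) \<le> 1"
  using assms by (auto simp: unit_class_def)

text \<open>\<open>W\<close> bounds \<open>exp_conv n h\<close>, and \<open>Cs\<close> bounds the integral of \<open>(T h)\<^sup>s\<close>, for all admissible \<open>h\<close>.\<close>

definition W where "W = 1 / \<bar>n\<bar> + 1"
definition Cs where "Cs = \<bar>m\<bar> powr (- s) * \<bar>n\<bar> powr (- s)"

lemma W_pos: "0 < W" and Cs_pos: "0 < Cs" using m n by (auto simp: W_def Cs_def add_pos_pos)

text \<open>Images of admissible functions are uniformly bounded and uniformly Lipschitz, because the outer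
  convolution solves a first order equation whose right-hand side is bounded uniformly.\<close>

lemma unit_class_bounds:
  assumes h: "h \<in> unit_class"
  shows "exp_conv2 m n h t \<le> W / \<bar>m\<bar>" "\<bar>exp_conv2 m n h x - exp_conv2 m n h y\<bar> \<le> 2 * W * \<bar>x - y\<bar>"
proof -
  note h = unit_classD[OF h]
  have w: "exp_conv n h t \<le> W" for t
    using exp_conv_le_Lr[OF n h(1) s(1) h(2), of t] h(3) by (simp add: W_def)
  have bw: "nonneg_Cb (exp_conv n h)" using n h by (simp add: exp_conv_nonneg_Cb)
  have f: "exp_conv2 m n h t \<le> W / \<bar>m\<bar>" for t
    unfolding exp_conv2_def by (intro exp_conv_le m w bw)
  then show "exp_conv2 m n h t \<le> W / \<bar>m\<bar>" .
  show "\<bar>exp_conv2 m n h x - exp_conv2 m n h y\<bar> \<le> 2 * W * \<bar>x - y\<bar>"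
    unfolding exp_conv2_def
  proof (rule mvt_Lipschitz[OF exp_conv_DERIV[OF m bw]])
    fix t
    have "\<bar>sgn m * exp_conv n h t\<bar> \<le> W"
      using w[of t] nonneg_Cb_nonneg[OF bw, of t] m by (simp add: abs_mult abs_sgn_eq)
    moreover have "\<bar>m * exp_conv m (exp_conv n h) t\<bar> \<le> \<bar>m\<bar> * (W / \<bar>m\<bar>)"
      using f[of t] exp_conv_nonneg[OF bw, of m t] unfolding abs_mult exp_conv2_def
      by (intro mult_left_mono) auto
    ultimately show "\<bar>sgn m * exp_conv n h t - m * exp_conv m (exp_conv n h) t\<bar> \<le> 2 * W"
      using m by simp
  qed
qed

text \<open>Since \<open>s < q\<close>, the functional is controlled by the sup norm of \<open>T h\<close>. Hence \<open>T h\<close> cannot be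
  uniformly small when \<open>Q h\<close> is bounded below, which excludes vanishing.\<close>

lemma unit_class_Q:
  assumes h: "h \<in> unit_class"
  shows "integrable lborel (\<lambda>t. exp_conv2 m n h t powr q)"
    "(\<And>t. exp_conv2 m n h t \<le> L) \<Longrightarrow> Q h \<le> L powr (q - s) * Cs"
proof -
  note h' = unit_classD[OF h]
  note b = exp_conv2_nonneg_Cb[OF m n h'(1)]
  note Ls = exp_conv2_Lr[OF m n h'(1) s(1) h'(2)]
  note * = integrable_powr_mono_exponent[OF b _ _ Ls(1), of q]
  show "integrable lborel (\<lambda>t. exp_conv2 m n h t powr q)"
    by (rule *(1)[OF _ _ unit_class_bounds(1)[OF h]]) (use s in auto)
  assume L: "\<And>t. exp_conv2 m n h t \<le> L"
  have "Q h \<le> L powr (q - s) * (\<integral>t. exp_conv2 m n h t powr s \<partial>lborel)"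
    unfolding Q_def by (rule *(2)[OF _ _ L]) (use s in auto)
  also have "\<dots> \<le> L powr (q - s) * Cs"
  proof (intro mult_left_mono)
    have "(\<integral>t. exp_conv2 m n h t powr s \<partial>lborel) \<le> Cs * (\<integral>t. h t powr s \<partial>lborel)"
      using Ls(2) by (simp add: Cs_def)
    also have "\<dots> \<le> Cs * 1" using h' Cs_pos by (intro mult_left_mono) auto
    finally show "(\<integral>t. exp_conv2 m n h t powr s \<partial>lborel) \<le> Cs" by simp
  qed auto
  finally show "Q h \<le> L powr (q - s) * Cs" .
qed

lemma unit_class_shift:
  assumes h: "h \<in> unit_class"
  shows "(\<lambda>t. h (t + c)) \<in> unit_class" "Q (\<lambda>t. h (t + c)) = Q h"
proof -
  note h' = unit_classD[OF h]
  show "(\<lambda>t. h (t + c)) \<in> unit_class"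
    using nonneg_Cb_shift[OF h'(1), of c] lborel_integrable_real_affine[OF h'(2), of 1 c] h'(3)
      lborel_integral_real_affine[of 1 "\<lambda>t. h t powr s" c]
    by (simp add: unit_class_def add.commute)
  show "Q (\<lambda>t. h (t + c)) = Q h"
    using lborel_integral_real_affine[of 1 "\<lambda>t. exp_conv2 m n h t powr q" c]
    by (simp add: Q_def exp_conv2_shift add.commute)
qed

lemma exists_Q_pos: "\<exists>h\<in>unit_class. 0 < Q h"
proof -
  define h0 :: "real \<Rightarrow> real" where "h0 t = exp (- \<bar>t\<bar>)" for t
  have bh0: "nonneg_Cb h0"
    unfolding nonneg_Cb_def h0_def by (auto intro!: continuous_intros exI[of _ 1])
  note [measurable] = nonneg_Cb_measurable[OF bh0]
  have i0: "integrable lborel (\<lambda>t. h0 t powr s)"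
  proof (rule Bochner_Integration.integrable_bound)
    show "integrable lborel (\<lambda>t. exp_kernel s t + exp_kernel (- s) t)"
      using s by (intro Bochner_Integration.integrable_add integrable_exp_kernel) auto
    have "h0 t powr s \<le> exp_kernel s t + exp_kernel (- s) t" for t
      using s(1) by (cases "0 \<le> t") (auto simp: h0_def exp_kernel_def exp_powr_real zero_le_mult_iff mult_le_0_iff algebra_simps)
    then show "AE t in lborel. norm (h0 t powr s) \<le> norm (exp_kernel s t + exp_kernel (- s) t)"
      by auto
  qed measurable
  define I where "I = (\<integral>t. h0 t powr s \<partial>lborel)"
  have I: "0 \<le> I" unfolding I_def by (intro integral_nonneg_AE) auto
  define c where "c = 1 / (1 + I)"
  have c: "0 < c" "c \<le> 1" "c * I \<le> 1" using I by (auto simp: c_def field_simps)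
  define h where "h t = c * h0 t" for t
  have bh: "nonneg_Cb h" unfolding h_def using bh0 c by (intro nonneg_Cb_cmult) auto
  have hs: "h t powr s = c powr s * h0 t powr s" for t
    using c by (simp add: h_def powr_mult h0_def)
  have "c powr s \<le> c powr 1" using c s by (intro powr_mono') auto
  then have "c powr s * I \<le> c * I" using c I by (intro mult_right_mono) auto
  then have hc: "h \<in> unit_class"
    using bh i0 c by (simp add: unit_class_def hs I_def)
  have pos: "0 < exp_conv2 m n h t" for t
    unfolding exp_conv2_def
    by (intro exp_conv_pos exp_conv_nonneg_Cb m n bh) (use c in \<open>auto simp: h_def h0_def\<close>)
  have "0 < Q h"
  proof (rule ccontr)
    assume "\<not> 0 < Q h"
    moreover have "0 \<le> Q h" unfolding Q_def by (intro integral_nonneg_AE) auto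
    ultimately have "Q h = 0" by simp
    then have "AE t in lborel. exp_conv2 m n h t powr q = 0"
      unfolding Q_def using unit_class_Q(1)[OF hc] by (subst (asm) integral_nonneg_eq_0_iff_AE) auto
    then have "AE t in (lborel::real measure). False"
      by (rule eventually_mono) (use pos in \<open>auto simp: less_le\<close>)
    then show False by (simp add: trivial_limit_def[symmetric] ae_filter_eq_bot_iff)
  qed
  then show ?thesis using hc by blast
qed

text \<open>The admissible function that maximises the pairing with \<open>g = T* ((T h)\<^sup>q\<^sup>-\<^sup>1)\<close>, when \<open>A\<close> is the \<open>L\<^sup>p\<close> norm of \<open>g\<close>. A maximiser is a fixed point of this map.\<close>

definition improve :: "(real \<Rightarrow> real) \<Rightarrow> real \<Rightarrow> real \<Rightarrow> real" where
  "improve h A t = (exp_conv2 (- n) (- m) (\<lambda>t. exp_conv2 m n h t powr (q - 1)) t / A) powr (p - 1)"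

text \<open>The deficit in Young's inequality for \<open>x\<^sup>q\<^sup>-\<^sup>1 y\<close>, multiplied by \<open>q\<close>: the distance at \<open>y\<close> between the graph
  of the \<open>q\<close>-th power and its tangent at \<open>x\<close>.\<close>

definition deficit :: "real \<Rightarrow> real \<Rightarrow> real" where
  "deficit x y = y powr q - x powr q - q * x powr (q - 1) * (y - x)"

lemma deficit_nonneg: "0 \<le> x \<Longrightarrow> 0 \<le> y \<Longrightarrow> 0 \<le> deficit x y"
  using powr_tangent[OF q, of y x] by (simp add: deficit_def)

lemma deficit_eq_0: "0 \<le> x \<Longrightarrow> 0 \<le> y \<Longrightarrow> deficit x y = 0 \<Longrightarrow> x = y"
  using powr_tangent_strict[OF q, of y x] by (force simp: deficit_def)

text \<open>With \<open>f = T h\<close>, \<open>F = f\<^sup>q\<^sup>-\<^sup>1\<close>, \<open>g = T* F\<close>, \<open>A = \<parallel>g\<parallel>\<^sub>p\<close> and \<open>f\<^sub>1\<close> the image of the improved function,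
  duality gives \<open>Q h = \<integral> g h \<le> A = \<integral> F f\<^sub>1\<close>. Integrating the deficit of \<open>f\<close> and \<open>f\<^sub>1\<close> bounds \<open>A\<close> by any
  upper bound \<open>M\<close> of the functional, and the integral of the deficit by \<open>q (M - Q h)\<close>. So near a
  maximum the improvement hardly changes \<open>T h\<close>.\<close>

lemma improve_step:
  assumes h: "h \<in> unit_class" and Qh: "0 < Q h" and M: "\<And>h. h \<in> unit_class \<Longrightarrow> Q h \<le> M"
  obtains A where "Q h \<le> A" "A \<le> M" "improve h A \<in> unit_class"
    "integrable lborel (\<lambda>t. deficit (exp_conv2 m n h t) (exp_conv2 m n (improve h A) t))"
    "(\<integral>t. deficit (exp_conv2 m n h t) (exp_conv2 m n (improve h A) t) \<partial>lborel) \<le> q * (M - Q h)"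
proof -
  note h' = unit_classD[OF h]
  define f where "f = exp_conv2 m n h"
  define F where "F t = f t powr (q - 1)" for t
  define g where "g = exp_conv2 (- n) (- m) F"
  have bf: "nonneg_Cb f" unfolding f_def by (intro exp_conv2_nonneg_Cb m n h')
  have bF: "nonneg_Cb F" unfolding F_def using q by (intro nonneg_Cb_powr bf) auto
  have bg: "nonneg_Cb g" unfolding g_def by (intro exp_conv2_nonneg_Cb m' n' bF)
  note [measurable] = nonneg_Cb_measurable[OF bf] nonneg_Cb_measurable[OF bF] nonneg_Cb_measurable[OF bg] nonneg_Cb_measurable[OF h'(1)]
  have fq: "integrable lborel (\<lambda>t. f t powr q)" unfolding f_def by (rule unit_class_Q(1)[OF h])
  have Fp: "integrable lborel (\<lambda>t. F t powr p)"
  proof -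
    have "q \<le> (q - 1) * p" using superlinear by (simp add: algebra_simps)
    then have "integrable lborel (\<lambda>t. f t powr ((q - 1) * p))"
      using integrable_powr_mono_exponent(1)[OF bf _ _ fq] unit_class_bounds(1)[OF h] q
      unfolding f_def by (metis less_trans zero_less_one)
    then show ?thesis by (simp add: F_def powr_powr)
  qed
  have gp: "integrable lborel (\<lambda>t. g t powr p)"
    unfolding g_def by (intro exp_conv2_Lr m' n' bF p Fp)
  define I where "I = (\<integral>t. g t powr p \<partial>lborel)"
  have I0: "0 \<le> I" unfolding I_def by (intro integral_nonneg_AE) auto
  have young: "x * y \<le> x powr p / p + y powr s / s" if "0 \<le> x" "0 \<le> y" for x y
    using that p s by (intro Youngs_inequality) auto
  have igh: "integrable lborel (\<lambda>t. g t * h t)"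
  proof (rule Bochner_Integration.integrable_bound)
    show "integrable lborel (\<lambda>t. g t powr p / p + h t powr s / s)" using gp h' by simp
    show "AE t in lborel. norm (g t * h t) \<le> norm (g t powr p / p + h t powr s / s)"
      using young nonneg_Cb_nonneg[OF bg] nonneg_Cb_nonneg[OF h'(1)] p s by (auto simp: abs_mult)
  qed measurable
  have Ff: "F t * f t = f t powr q" for t
    using nonneg_Cb_nonneg[OF bf, of t] by (cases "f t = 0") (auto simp: F_def powr_diff)
  have Qgh: "Q h = (\<integral>t. g t * h t \<partial>lborel)"
    using exp_conv2_duality(2)[OF m n bF h'(1)] igh by (simp add: g_def f_def[symmetric] Ff Q_def)
  have I: "0 < I"
  proof (rule ccontr)
    assume "\<not> 0 < I"
    then have "(\<integral>t. g t powr p \<partial>lborel) = 0" using I0 unfolding I_def by linarith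
    then have "AE t in lborel. g t powr p = 0"
      using gp by (subst (asm) integral_nonneg_eq_0_iff_AE) auto
    then have "AE t in lborel. g t * h t = 0" by eventually_elim auto
    then show False using Qh unfolding Qgh by (simp add: integral_eq_zero_AE)
  qed
  define A where "A = I powr (1 / p)"
  have A: "0 < A" "A powr p = I" using I p by (auto simp: A_def powr_powr)
  define h1 where "h1 = improve h A"
  have h1: "h1 t = (g t / A) powr (p - 1)" for t
    unfolding h1_def improve_def g_def F_def f_def ..
  have bh1: "nonneg_Cb h1"
  proof -
    have "nonneg_Cb (\<lambda>t. (1 / A * g t) powr (p - 1))" using A p by (intro nonneg_Cb_powr nonneg_Cb_cmult bg) auto
    then show ?thesis by (simp add: h1[abs_def])
  qed
  have h1s: "h1 t powr s = g t powr p / I" for t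
    using A s nonneg_Cb_nonneg[OF bg] by (simp add: h1 powr_powr powr_divide)
  have h1c: "h1 \<in> unit_class"
    using bh1 gp I by (simp add: unit_class_def h1s) (simp add: I_def)
  have gh1: "g t * h1 t = g t powr p / A powr (p - 1)" for t
    using nonneg_Cb_nonneg[OF bg, of t] A by (cases "g t = 0") (auto simp: h1 powr_divide powr_diff)
  have igh1: "integrable lborel (\<lambda>t. g t * h1 t)" unfolding gh1 using gp by simp
  have gh1A: "(\<integral>t. g t * h1 t \<partial>lborel) = A"
  proof -
    have "(\<integral>t. g t * h1 t \<partial>lborel) = A powr p / A powr (p - 1)"
      unfolding gh1 using A by (simp add: I_def)
    also have "\<dots> = A" using A(1) by (simp add: powr_diff[symmetric])
    finally show ?thesis .
  qed
  have QA: "Q h \<le> A"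
  proof -
    have "(\<integral>t. g t / A * h t \<partial>lborel) \<le> (\<integral>t. g t powr p / I / p + h t powr s / s \<partial>lborel)"
    proof (rule integral_mono)
      show "integrable lborel (\<lambda>t. g t / A * h t)" using igh by simp
      show "integrable lborel (\<lambda>t. g t powr p / I / p + h t powr s / s)" using gp h' by simp
      show "g t / A * h t \<le> g t powr p / I / p + h t powr s / s" for t
        using young[of "g t / A" "h t"] nonneg_Cb_nonneg[OF bg] nonneg_Cb_nonneg[OF h'(1)] A
        by (simp add: powr_divide)
    qed
    also have "\<dots> = I / I / p + (\<integral>t. h t powr s \<partial>lborel) / s"
      using gp h' by (simp add: I_def)
    also have "\<dots> \<le> 1 / p + 1 / s" using I h' s p by (intro add_mono divide_right_mono) auto
    finally have "(\<integral>t. g t * h t \<partial>lborel) / A \<le> 1" using s by simp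
    then show ?thesis using A by (simp add: Qgh)
  qed
  define f1 where "f1 = exp_conv2 m n h1"
  have bf1: "nonneg_Cb f1" unfolding f1_def by (intro exp_conv2_nonneg_Cb m n bh1)
  have f1q: "integrable lborel (\<lambda>t. f1 t powr q)" unfolding f1_def by (rule unit_class_Q(1)[OF h1c])
  have Ff1: "integrable lborel (\<lambda>t. F t * f1 t)" "(\<integral>t. F t * f1 t \<partial>lborel) = A"
    using exp_conv2_duality[OF m n bF bh1] igh1 gh1A by (auto simp: g_def f1_def)
  have D: "deficit (f t) (f1 t) = f1 t powr q + (q - 1) * f t powr q - q * (F t * f1 t)" for t
    using Ff[of t] by (simp add: deficit_def F_def algebra_simps)
  have iD: "integrable lborel (\<lambda>t. deficit (f t) (f1 t))"
    unfolding D using f1q fq Ff1 by simp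
  have ID: "(\<integral>t. deficit (f t) (f1 t) \<partial>lborel) = Q h1 + (q - 1) * Q h - q * A"
    unfolding D using f1q fq Ff1 by (simp add: Q_def f1_def f_def)
  have "0 \<le> (\<integral>t. deficit (f t) (f1 t) \<partial>lborel)"
    using nonneg_Cb_nonneg[OF bf] nonneg_Cb_nonneg[OF bf1] by (intro integral_nonneg_AE AE_I2 deficit_nonneg) auto
  moreover have "(q - 1) * Q h \<le> (q - 1) * M" using M[OF h] q by (intro mult_left_mono) auto
  ultimately have "q * A \<le> q * M" using M[OF h1c] unfolding ID by (simp add: algebra_simps)
  then have AM: "A \<le> M" using q by simp
  have "q * Q h \<le> q * A" using QA q by simp
  then have "(\<integral>t. deficit (f t) (f1 t) \<partial>lborel) \<le> q * (M - Q h)"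
    unfolding ID using M[OF h1c] \<open>(q - 1) * Q h \<le> (q - 1) * M\<close> by (simp add: algebra_simps)
  then show thesis
    using that[of A] QA AM h1c iD unfolding h1_def f_def f1_def by blast
qed

text \<open>Take admissible functions on which the functional tends to its supremum, translated so that the
  values of their images at \<open>0\<close> stay above a positive constant. Along a subsequence the images
  converge pointwise, hence so do the images of the improved functions. By Fatou's lemma the deficit of the two limits has integral \<open>0\<close>, so they agree.\<close>

lemma exists_scaled_fixed_point:
  "\<exists>f c. nonneg_Cb f \<and> 0 < f 0 \<and> 0 < c \<and> integrable lborel (\<lambda>t. f t powr q) \<and>
    (\<forall>t. f t = c * exp_conv2 m n (\<lambda>t. exp_conv2 (- n) (- m) (\<lambda>t. f t powr (q - 1)) t powr (p - 1)) t)"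
proof -
  define B where "B = W / \<bar>m\<bar>"
  have bdd: "bdd_above (Q ` unit_class)"
    using unit_class_Q(2)[OF _ unit_class_bounds(1)] by (intro bdd_aboveI2) blast
  define M where "M = (SUP h\<in>unit_class. Q h)"
  have QM: "Q h \<le> M" if "h \<in> unit_class" for h
    unfolding M_def using that bdd by (rule cSUP_upper)
  have M: "0 < M" using exists_Q_pos QM by force
  have near: "\<exists>h\<in>unit_class. y < Q h" if "y < M" for y
    using that exists_Q_pos bdd unfolding M_def by (subst (asm) less_cSUP_iff) auto
  define c0 where "c0 = (M / 2 / Cs) powr (1 / (q - s))"
  have c0: "0 < c0" using M Cs_pos by (simp add: c0_def)
  \<comment> \<open>an image below \<open>c0\<close> everywhere would make the functional at most \<open>M / 2\<close>\<close>
  have c0': "c0 powr (q - s) * Cs = M / 2"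
    using M Cs_pos s(2) by (simp add: c0_def powr_powr)
  have "\<exists>h\<in>unit_class. max (M / 2) (M - 1 / real (Suc k)) < Q h \<and> c0 \<le> exp_conv2 m n h 0" for k
  proof -
    obtain h where h: "h \<in> unit_class" "max (M / 2) (M - 1 / real (Suc k)) < Q h"
      using near[of "max (M / 2) (M - 1 / real (Suc k))"] M by auto
    have "\<not> (\<forall>t. exp_conv2 m n h t \<le> c0)"
      using unit_class_Q(2)[OF h(1), of c0] h(2) c0' by force
    then obtain t where "c0 < exp_conv2 m n h t" by (auto simp: not_le)
    then have "c0 \<le> exp_conv2 m n (\<lambda>y. h (y + t)) 0" by (simp add: exp_conv2_shift)
    then show ?thesis using unit_class_shift[OF h(1), of t] h(2) by (intro bexI[of _ "\<lambda>y. h (y + t)"]) simp_all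
  qed
  then have "\<forall>k. \<exists>h. h \<in> unit_class \<and> max (M / 2) (M - 1 / real (Suc k)) < Q h \<and> c0 \<le> exp_conv2 m n h 0"
    by blast
  from choice[OF this] obtain h0 where h0': "\<And>k. h0 k \<in> unit_class \<and>
      max (M / 2) (M - 1 / real (Suc k)) < Q (h0 k) \<and> c0 \<le> exp_conv2 m n (h0 k) 0"
    by auto
  then have h0: "h0 k \<in> unit_class" "M / 2 < Q (h0 k)"
      "M - 1 / real (Suc k) < Q (h0 k)" "c0 \<le> exp_conv2 m n (h0 k) 0" for k
    unfolding max_less_iff_conj by blast+
  obtain r where r: "strict_mono r" "\<And>x. convergent (\<lambda>k. exp_conv2 m n (h0 (r k)) x)"
  proof (rule pointwise_convergent_subsequence[of "\<lambda>k. exp_conv2 m n (h0 k)" "2 * W" B])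
    show "\<bar>exp_conv2 m n (h0 k) x\<bar> \<le> B" for k x
      using unit_class_bounds(1)[OF h0(1)] nonneg_Cb_nonneg[OF exp_conv2_nonneg_Cb[OF m n unit_classD(1)[OF h0(1)]]]
      by (simp add: B_def)
  qed (use unit_class_bounds(2)[OF h0(1)] W_pos in auto)
  define h where "h k = h0 (r k)" for k
  have h: "h k \<in> unit_class" "M / 2 < Q (h k)" "c0 \<le> exp_conv2 m n (h k) 0" for k
    using h0 by (auto simp: h_def)
  have Qh_lim: "(\<lambda>k. Q (h k)) \<longlonglongrightarrow> M"
  proof (rule tendsto_sandwich[OF _ _ _ tendsto_const])
    have "(\<lambda>k. M - 1 / real (Suc (r k))) \<longlonglongrightarrow> M - 0"
      using LIMSEQ_subseq_LIMSEQ[OF LIMSEQ_Suc[OF lim_1_over_n] r(1)]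
      by (intro tendsto_intros) (simp add: o_def)
    then show "(\<lambda>k. M - 1 / real (Suc (r k))) \<longlonglongrightarrow> M" by simp
  qed (use h0(3) QM[OF h(1)] in \<open>auto simp: h_def less_imp_le\<close>)
  define f where "f k = exp_conv2 m n (h k)" for k
  define \<phi> where "\<phi> t = lim (\<lambda>k. f k t)" for t
  have lim: "(\<lambda>k. f k t) \<longlonglongrightarrow> \<phi> t" for t
    unfolding \<phi>_def f_def h_def using r(2) by (simp add: convergent_LIMSEQ_iff)
  have bf: "nonneg_Cb (f k)" for k unfolding f_def by (intro exp_conv2_nonneg_Cb m n unit_classD(1)[OF h(1)])
  have fB: "f k t \<le> B" for k t unfolding f_def B_def by (rule unit_class_bounds(1)[OF h(1)])
  have \<phi>_nn: "0 \<le> \<phi> t" for t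
    by (rule LIMSEQ_le_const[OF lim]) (use nonneg_Cb_nonneg[OF bf] in auto)
  have \<phi>_B: "\<phi> t \<le> B" for t
    by (rule LIMSEQ_le_const2[OF lim]) (use fB in auto)
  have \<phi>_Lip: "\<bar>\<phi> x - \<phi> y\<bar> \<le> 2 * W * \<bar>x - y\<bar>" for x y
    by (rule LIMSEQ_le_const2[OF tendsto_rabs[OF tendsto_diff[OF lim lim]]])
       (use unit_class_bounds(2)[OF h(1)] in \<open>auto simp: f_def\<close>)
  have \<phi>_cont: "continuous_on UNIV \<phi>"
    by (rule lipschitz_on_continuous_on[of "2 * W"])
       (use \<phi>_Lip W_pos in \<open>auto simp: lipschitz_on_def dist_real_def\<close>)
  have b\<phi>: "nonneg_Cb \<phi>" using \<phi>_nn \<phi>_B \<phi>_cont by (auto simp: nonneg_Cb_def)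
  have \<phi>0: "0 < \<phi> 0"
    using LIMSEQ_le_const[OF lim[of 0], of c0] h(3) c0 by (force simp: f_def)
  have "\<exists>A. Q (h k) \<le> A \<and> A \<le> M \<and> improve (h k) A \<in> unit_class \<and>
    integrable lborel (\<lambda>t. deficit (exp_conv2 m n (h k) t) (exp_conv2 m n (improve (h k) A) t)) \<and>
    (\<integral>t. deficit (exp_conv2 m n (h k) t) (exp_conv2 m n (improve (h k) A) t) \<partial>lborel) \<le> q * (M - Q (h k))" for k
  proof -
    have "0 < Q (h k)" using h(2)[of k] M by linarith
    then show ?thesis by (rule improve_step[OF h(1)[of k] _ QM]) auto
  qed
  then have "\<forall>k. \<exists>A. Q (h k) \<le> A \<and> A \<le> M \<and> improve (h k) A \<in> unit_class \<and>
    integrable lborel (\<lambda>t. deficit (f k t) (exp_conv2 m n (improve (h k) A) t)) \<and>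
    (\<integral>t. deficit (f k t) (exp_conv2 m n (improve (h k) A) t) \<partial>lborel) \<le> q * (M - Q (h k))"
    unfolding f_def by blast
  from choice[OF this] obtain A where A: "\<And>k. Q (h k) \<le> A k" "\<And>k. A k \<le> M" "\<And>k. improve (h k) (A k) \<in> unit_class"
    "\<And>k. integrable lborel (\<lambda>t. deficit (f k t) (exp_conv2 m n (improve (h k) (A k)) t))"
    "\<And>k. (\<integral>t. deficit (f k t) (exp_conv2 m n (improve (h k) (A k)) t) \<partial>lborel) \<le> q * (M - Q (h k))"
    by auto
  define h1 where "h1 k = improve (h k) (A k)" for k
  define f1 where "f1 k = exp_conv2 m n (h1 k)" for k
  have bf1: "nonneg_Cb (f1 k)" for k unfolding f1_def h1_def by (intro exp_conv2_nonneg_Cb m n unit_classD(1)[OF A(3)])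
  have A_lim: "A \<longlonglongrightarrow> M"
    by (rule tendsto_sandwich[OF _ _ Qh_lim tendsto_const]) (use A in auto)
  define g where "g k = exp_conv2 (- n) (- m) (\<lambda>t. f k t powr (q - 1))" for k
  define \<gamma> where "\<gamma> = exp_conv2 (- n) (- m) (\<lambda>t. \<phi> t powr (q - 1))"
  have bF: "nonneg_Cb (\<lambda>t. f k t powr (q - 1))" for k using q by (intro nonneg_Cb_powr bf) auto
  have bg: "nonneg_Cb (g k)" for k unfolding g_def by (intro exp_conv2_nonneg_Cb m' n' bF)
  have b\<gamma>: "nonneg_Cb \<gamma>" unfolding \<gamma>_def using q by (intro exp_conv2_nonneg_Cb m' n' nonneg_Cb_powr b\<phi>) auto
  have FB: "f k t powr (q - 1) \<le> B powr (q - 1)" for k t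
    using fB nonneg_Cb_nonneg[OF bf] q by (intro powr_mono2) auto
  have g_lim: "(\<lambda>k. g k t) \<longlonglongrightarrow> \<gamma> t" for t
    unfolding g_def \<gamma>_def
  proof (rule exp_conv2_tendsto[OF n' m' bF _ FB])
    show "(\<lambda>k. f k t powr (q - 1)) \<longlonglongrightarrow> \<phi> t powr (q - 1)" for t
      by (rule tendsto_powr'[OF lim tendsto_const]) (use q nonneg_Cb_nonneg[OF bf] in auto)
  qed
  define Bg where "Bg = B powr (q - 1) / \<bar>- m\<bar> / \<bar>- n\<bar>"
  have gB: "g k t \<le> Bg" for k t
    unfolding g_def Bg_def by (rule exp_conv2_le[OF n' m' bF FB])
  have h1: "h1 k t = (g k t / A k) powr (p - 1)" for k t
    by (simp add: h1_def improve_def g_def f_def)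
  have A_pos: "M / 2 \<le> A k" for k using A(1)[of k] h(2)[of k] by simp
  have f1_lim: "(\<lambda>k. f1 k t) \<longlonglongrightarrow> exp_conv2 m n (\<lambda>t. (\<gamma> t / M) powr (p - 1)) t" for t
    unfolding f1_def
  proof (rule exp_conv2_tendsto[OF m n])
    show "nonneg_Cb (h1 k)" for k unfolding h1_def by (rule unit_classD(1)[OF A(3)])
    show "(\<lambda>k. h1 k t) \<longlonglongrightarrow> (\<gamma> t / M) powr (p - 1)" for t
      unfolding h1
    proof (rule tendsto_powr'[OF tendsto_divide[OF g_lim A_lim] tendsto_const])
      have "0 \<le> g k t / A k" for k using nonneg_Cb_nonneg[OF bg[of k], of t] A_pos[of k] M by simp
      then show "\<gamma> t / M \<noteq> 0 \<or> 0 < p - 1 \<and> (\<forall>\<^sub>F k in sequentially. 0 \<le> g k t / A k)"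
        using p by auto
    qed (use M in auto)
    show "h1 k t \<le> (Bg / (M / 2)) powr (p - 1)" for k t
      unfolding h1 using nonneg_Cb_nonneg[OF bg[of k], of t] A_pos[of k] M p gB[of k t]
      by (intro powr_mono2 frac_le divide_nonneg_pos) linarith+
  qed
  define \<psi> where "\<psi> = exp_conv2 m n (\<lambda>t. (\<gamma> t / M) powr (p - 1))"
  have b\<psi>: "nonneg_Cb \<psi>"
  proof -
    have "nonneg_Cb (\<lambda>t. (1 / M * \<gamma> t) powr (p - 1))" using M p by (intro nonneg_Cb_powr nonneg_Cb_cmult b\<gamma>) auto
    then show ?thesis unfolding \<psi>_def by (intro exp_conv2_nonneg_Cb m n) simp
  qed
  note [measurable] = nonneg_Cb_measurable[OF bf] nonneg_Cb_measurable[OF bf1] nonneg_Cb_measurable[OF b\<phi>] nonneg_Cb_measurable[OF b\<psi>]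
  have nn_D: "0 \<le> deficit (f k t) (f1 k t)" for k t
    by (intro deficit_nonneg nonneg_Cb_nonneg[OF bf] nonneg_Cb_nonneg[OF bf1])
  have D_lim: "(\<lambda>k. deficit (f k t) (f1 k t)) \<longlonglongrightarrow> deficit (\<phi> t) (\<psi> t)" for t
    unfolding deficit_def \<psi>_def
    using q nonneg_Cb_nonneg[OF bf] nonneg_Cb_nonneg[OF bf1]
    by (intro tendsto_intros tendsto_powr'[OF _ tendsto_const] lim f1_lim) auto
  have [measurable]: "(\<lambda>t. deficit (\<phi> t) (\<psi> t)) \<in> borel_measurable borel"
      "(\<lambda>t. deficit (f k t) (f1 k t)) \<in> borel_measurable borel" for k
    unfolding deficit_def by measurable
  have "(\<integral>\<^sup>+t. ennreal (deficit (\<phi> t) (\<psi> t)) \<partial>lborel)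
     = (\<integral>\<^sup>+t. liminf (\<lambda>k. ennreal (deficit (f k t) (f1 k t))) \<partial>lborel)"
    using D_lim by (intro nn_integral_cong lim_imp_Liminf[symmetric]) (auto intro: tendsto_ennrealI)
  also have "\<dots> \<le> liminf (\<lambda>k. \<integral>\<^sup>+t. ennreal (deficit (f k t) (f1 k t)) \<partial>lborel)"
    by (intro nn_integral_liminf) measurable
  also have "\<dots> \<le> liminf (\<lambda>k. ennreal (q * (M - Q (h k))))"
    using A(4,5) nn_D unfolding f1_def h1_def
    by (intro Liminf_mono always_eventually allI) (simp add: nn_integral_eq_integral ennreal_leI)
  also have "\<dots> = ennreal (q * (M - M))"
    by (intro lim_imp_Liminf tendsto_ennrealI tendsto_intros Qh_lim) auto
  finally have "(\<integral>\<^sup>+t. ennreal (deficit (\<phi> t) (\<psi> t)) \<partial>lborel) = 0" by simp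
  then have "AE t in lborel. ennreal (deficit (\<phi> t) (\<psi> t)) = 0"
    by (subst (asm) nn_integral_0_iff_AE) auto
  then have "AE t in lborel. \<phi> t = \<psi> t"
  proof eventually_elim
    case (elim t)
    then have "deficit (\<phi> t) (\<psi> t) = 0"
      using deficit_nonneg[of "\<phi> t" "\<psi> t"] \<phi>_nn nonneg_Cb_nonneg[OF b\<psi>] by simp
    then show ?case using deficit_eq_0 \<phi>_nn nonneg_Cb_nonneg[OF b\<psi>] by blast
  qed
  then have eq: "\<phi> t = \<psi> t" for t
    using b\<phi> b\<psi> by (intro continuous_AE_eq) (auto simp: nonneg_Cb_def)
  have "(\<integral>\<^sup>+t. ennreal (\<phi> t powr q) \<partial>lborel) = (\<integral>\<^sup>+t. liminf (\<lambda>k. ennreal (f k t powr q)) \<partial>lborel)"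
  proof (intro nn_integral_cong lim_imp_Liminf[symmetric] tendsto_ennrealI)
    show "(\<lambda>k. f k t powr q) \<longlonglongrightarrow> \<phi> t powr q" for t
      by (rule tendsto_powr'[OF lim tendsto_const]) (use q nonneg_Cb_nonneg[OF bf] in auto)
  qed auto
  also have "\<dots> \<le> liminf (\<lambda>k. \<integral>\<^sup>+t. ennreal (f k t powr q) \<partial>lborel)"
    by (intro nn_integral_liminf) measurable
  also have "\<dots> \<le> liminf (\<lambda>k. ennreal M)"
    using QM[OF h(1)] unit_class_Q(1)[OF h(1)] unfolding f_def Q_def
    by (intro Liminf_mono always_eventually allI) (simp add: nn_integral_eq_integral ennreal_leI)
  also have "\<dots> < \<infinity>" by (simp add: Liminf_const)
  finally have i\<phi>: "integrable lborel (\<lambda>t. \<phi> t powr q)"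
    by (intro integrableI_nonneg) auto
  have fixeq: "\<phi> t = (1 / M) powr (p - 1) * exp_conv2 m n (\<lambda>t. \<gamma> t powr (p - 1)) t" for t
  proof -
    have "(\<gamma> t / M) powr (p - 1) = (1 / M) powr (p - 1) * \<gamma> t powr (p - 1)" for t
      using M nonneg_Cb_nonneg[OF b\<gamma>] by (simp add: powr_mult[symmetric])
    then show ?thesis unfolding eq \<psi>_def by (simp add: exp_conv2_cmult)
  qed
  have "0 < (1 / M) powr (p - 1)" using M by simp
  then show ?thesis
    using b\<phi> \<phi>0 i\<phi> fixeq unfolding \<gamma>_def by blast
qed

text \<open>The system has total homogeneity \<open>(p - 1)(q - 1) \<noteq> 1\<close>, so multiplying \<open>f\<close> by a constant removes the factor \<open>c\<close>.\<close>

lemma exists_fixed_point: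
  obtains f g where "nonneg_Cb f" "nonneg_Cb g" "0 < f 0" "integrable lborel (\<lambda>t. f t powr q)" "integrable lborel (\<lambda>t. g t powr p)"
    "f = exp_conv2 m n (\<lambda>t. g t powr (p - 1))" "g = exp_conv2 (- n) (- m) (\<lambda>t. f t powr (q - 1))"
proof -
  obtain \<phi> c where \<phi>: "nonneg_Cb \<phi>" "0 < \<phi> 0" "0 < c" "integrable lborel (\<lambda>t. \<phi> t powr q)"
    "\<And>t. \<phi> t = c * exp_conv2 m n (\<lambda>t. exp_conv2 (- n) (- m) (\<lambda>t. \<phi> t powr (q - 1)) t powr (p - 1)) t"
    using exists_scaled_fixed_point by blast
  define e where "e = (p - 1) * (q - 1)"
  define \<sigma> where "\<sigma> = c powr (1 / (e - 1))"
  have e: "1 < e" using superlinear by (simp add: e_def)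
  have \<sigma>: "0 < \<sigma>" "\<sigma> powr e = \<sigma> * c"
  proof -
    show "0 < \<sigma>" using \<phi>(3) by (simp add: \<sigma>_def)
    have "\<sigma> powr (e - 1) = c" using \<phi>(3) e by (simp add: \<sigma>_def powr_powr)
    then show "\<sigma> powr e = \<sigma> * c" using \<open>0 < \<sigma>\<close> by (simp add: powr_diff field_simps)
  qed
  define \<gamma> where "\<gamma> = exp_conv2 (- n) (- m) (\<lambda>t. \<phi> t powr (q - 1))"
  define f where "f t = \<sigma> * \<phi> t" for t
  define g where "g = exp_conv2 (- n) (- m) (\<lambda>t. f t powr (q - 1))"
  have bf: "nonneg_Cb f" unfolding f_def using \<phi>(1) \<sigma> by (intro nonneg_Cb_cmult) auto
  have bF: "nonneg_Cb (\<lambda>t. f t powr (q - 1))" using q by (intro nonneg_Cb_powr bf) auto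
  have bg: "nonneg_Cb g" unfolding g_def by (intro exp_conv2_nonneg_Cb m' n' bF)
  have b\<gamma>: "nonneg_Cb \<gamma>" unfolding \<gamma>_def using q by (intro exp_conv2_nonneg_Cb m' n' nonneg_Cb_powr \<phi>(1)) auto
  have fq: "integrable lborel (\<lambda>t. f t powr q)"
    using \<phi>(4) \<sigma> nonneg_Cb_nonneg[OF \<phi>(1)] by (simp add: f_def powr_mult)
  obtain B where B: "\<And>t. f t \<le> B" using bf by (auto simp: nonneg_Cb_def)
  have "q \<le> (q - 1) * p" using superlinear by (simp add: algebra_simps)
  then have "integrable lborel (\<lambda>t. f t powr ((q - 1) * p))"
    using integrable_powr_mono_exponent(1)[OF bf _ _ fq B] q by (meson less_trans zero_less_one)
  then have gp: "integrable lborel (\<lambda>t. g t powr p)"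
    unfolding g_def by (intro exp_conv2_Lr m' n' bF p) (simp add: powr_powr)
  have g: "g t = \<sigma> powr (q - 1) * \<gamma> t" for t
  proof -
    have "f t powr (q - 1) = \<sigma> powr (q - 1) * \<phi> t powr (q - 1)" for t
      using \<sigma> nonneg_Cb_nonneg[OF \<phi>(1)] by (simp add: f_def powr_mult)
    then show ?thesis unfolding g_def \<gamma>_def by (simp add: exp_conv2_cmult)
  qed
  have "f t = exp_conv2 m n (\<lambda>t. g t powr (p - 1)) t" for t
  proof -
    have "g t powr (p - 1) = \<sigma> powr e * \<gamma> t powr (p - 1)" for t
      using \<sigma> nonneg_Cb_nonneg[OF b\<gamma>] by (simp add: g powr_mult powr_powr e_def mult.commute)
    then have "exp_conv2 m n (\<lambda>t. g t powr (p - 1)) t = \<sigma> * (c * exp_conv2 m n (\<lambda>t. \<gamma> t powr (p - 1)) t)"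
      by (simp add: exp_conv2_cmult \<sigma>)
    also have "\<dots> = f t" unfolding f_def \<gamma>_def \<phi>(5)[symmetric] ..
    finally show ?thesis by simp
  qed
  then have "f = exp_conv2 m n (\<lambda>t. g t powr (p - 1))" by (rule ext)
  moreover have "0 < f 0" using \<phi>(2) \<sigma>(1) by (simp add: f_def)
  ultimately show thesis using bf bg fq gp by (intro that[of f g] g_def)
qed

end

section \<open>The Laplacian of radial functions in the logarithm of the radius\<close>

lemma line_ln_norm_DERIV:
  fixes x i :: "'a::euclidean_space"
  assumes x: "x \<noteq> 0" and i: "i \<in> Basis"
  shows "((\<lambda>t. ln (norm (x + t *\<^sub>R i))) has_real_derivative (x \<bullet> i) / (norm x)\<^sup>2) (at 0)"
proof -
  have e: "ln (norm (x + t *\<^sub>R i)) = ln (x \<bullet> x + 2 * t * (x \<bullet> i) + t\<^sup>2) / 2" for t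
  proof -
    have "x \<bullet> x + 2 * t * (x \<bullet> i) + t\<^sup>2 = (norm (x + t *\<^sub>R i))\<^sup>2"
      unfolding power2_norm_eq_inner using i
      by (simp add: inner_add_left inner_add_right inner_commute power2_eq_square)
    then show ?thesis
      by (cases "x + t *\<^sub>R i = 0") (simp_all add: ln_realpow)
  qed
  have xx: "0 < x \<bullet> x" using x by simp
  have "((\<lambda>t. ln (x \<bullet> x + 2 * t * (x \<bullet> i) + t\<^sup>2) / 2) has_real_derivative
      (2 * (x \<bullet> i)) / (x \<bullet> x) / 2) (at 0)"
    using xx by (auto intro!: derivative_eq_intros)
  then show ?thesis by (simp add: e power2_norm_eq_inner)
qed

lemma line_radial_DERIV:
  fixes x i :: "'a::euclidean_space"
  assumes x: "x \<noteq> 0" and i: "i \<in> Basis" and K: "\<And>t. (K has_real_derivative K' t) (at t)"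
  shows "((\<lambda>t. K (ln (norm (x + t *\<^sub>R i)))) has_real_derivative
      K' (ln (norm x)) * ((x \<bullet> i) / (norm x)\<^sup>2)) (at 0)"
  using DERIV_chain2[where f = K and g = "\<lambda>t. ln (norm (x + t *\<^sub>R i))" and x = 0, OF _ line_ln_norm_DERIV[OF x i]] K
  by simp

lemma line_radial_inner_DERIV:
  fixes x i j :: "'a::euclidean_space"
  assumes x: "x \<noteq> 0" and i: "i \<in> Basis" and K: "\<And>t. (K has_real_derivative K' t) (at t)"
  shows "((\<lambda>t. K (ln (norm (x + t *\<^sub>R i))) * ((x + t *\<^sub>R i) \<bullet> j)) has_real_derivative
      K' (ln (norm x)) * ((x \<bullet> i) / (norm x)\<^sup>2) * (x \<bullet> j) + K (ln (norm x)) * (i \<bullet> j)) (at 0)"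
proof -
  have "((\<lambda>t. (x + t *\<^sub>R i) \<bullet> j) has_real_derivative i \<bullet> j) (at 0)"
    unfolding inner_add_left inner_scaleR_left by (auto intro!: derivative_eq_intros)
  from DERIV_mult[OF line_radial_DERIV[OF x i K] this] show ?thesis
    by (simp add: algebra_simps)
qed

text \<open>A partial derivative only depends on the values near the point.\<close>

lemma line_DERIV_cong:
  fixes x i :: "'a::euclidean_space"
  assumes "((\<lambda>t. w (x + t *\<^sub>R i)) has_real_derivative d) (at 0)" "open S" "x \<in> S" "\<And>y. y \<in> S \<Longrightarrow> u y = w y"
  shows "((\<lambda>t. u (x + t *\<^sub>R i)) has_real_derivative d) (at 0)"
proof (rule has_field_derivative_transform_within_open[OF assms(1)])
  show "open ((\<lambda>t. x + t *\<^sub>R i) -` S)"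
    by (rule open_vimage[OF assms(2)]) (intro continuous_intros)
qed (use assms in auto)

text \<open>With \<open>t = ln \<bar>x\<bar>\<close>, the polar form of the Laplacian of a radial function is \<open>\<bar>x\<bar>\<^sup>-\<^sup>2 (F'' + (N - 2) F')\<close>,
  where \<open>N\<close> is the dimension.\<close>

lemma radial_profile_Ck_laplacian:
  fixes u :: "'a::euclidean_space \<Rightarrow> real"
  assumes F: "\<And>t. (F has_real_derivative F' t) (at t)" and F': "\<And>t. (F' has_real_derivative F'' t) (at t)"
    and F'': "continuous_on UNIV F''" and u: "\<And>x. x \<noteq> 0 \<Longrightarrow> u x = F (ln (norm x))"
  shows "Ck_on 2 (- {0}) u"
    and "x \<noteq> 0 \<Longrightarrow> laplacian u x = (F'' (ln (norm x)) + (real DIM('a) - 2) * F' (ln (norm x))) / (norm x)\<^sup>2"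
proof -
  \<comment> \<open>in these terms the gradient of \<open>F (ln \<bar>x\<bar>)\<close> is \<open>K (ln \<bar>x\<bar>) x\<close>\<close>
  define K where "K t = F' t * exp (- (2 * t))" for t
  define K' where "K' t = (F'' t - 2 * F' t) * exp (- (2 * t))" for t
  have K: "(K has_real_derivative K' t) (at t)" for t
    unfolding K_def K'_def by (auto intro!: derivative_eq_intros F' simp: algebra_simps)
  have exp2: "exp (- (2 * ln (norm x))) = 1 / (norm x)\<^sup>2" if "x \<noteq> 0" for x :: 'a
    using that exp_of_nat_mult[of 2 "ln (norm x)"] by (simp add: exp_minus divide_inverse)
  have op: "open (- {0::'a})" by auto
  have d1: "((\<lambda>t. u (x + t *\<^sub>R i)) has_real_derivative K (ln (norm x)) * (x \<bullet> i)) (at 0)"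
    if "x \<noteq> 0" "i \<in> Basis" for x i :: 'a
    using line_DERIV_cong[OF line_radial_DERIV[OF that F] op, of u] that u
    by (simp add: K_def exp2 mult.commute)
  then have p1: "partial_deriv i u x = K (ln (norm x)) * (x \<bullet> i)" if "x \<noteq> 0" "i \<in> Basis" for x i :: 'a
    unfolding partial_deriv_def using that by (intro DERIV_imp_deriv) auto
  have d2: "((\<lambda>t. partial_deriv i u (x + t *\<^sub>R j)) has_real_derivative
      K' (ln (norm x)) * ((x \<bullet> j) / (norm x)\<^sup>2) * (x \<bullet> i) + K (ln (norm x)) * (j \<bullet> i)) (at 0)"
    if "x \<noteq> 0" "i \<in> Basis" "j \<in> Basis" for x i j :: 'a
    using that p1 by (intro line_DERIV_cong[OF line_radial_inner_DERIV[OF _ _ K] op]) auto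
  then have p2: "partial_deriv j (partial_deriv i u) x =
      K' (ln (norm x)) * ((x \<bullet> j) / (norm x)\<^sup>2) * (x \<bullet> i) + K (ln (norm x)) * (j \<bullet> i)"
    if "x \<noteq> 0" "i \<in> Basis" "j \<in> Basis" for x i j :: 'a
    unfolding partial_deriv_def[of j] using that by (intro DERIV_imp_deriv) auto
  have cF: "continuous_on UNIV F" "continuous_on UNIV F'"
    using F F' by (meson DERIV_isCont continuous_at_imp_continuous_on)+
  have cK: "continuous_on UNIV K" "continuous_on UNIV K'"
    unfolding K_def K'_def by (intro continuous_intros cF F'')+
  have cl: "continuous_on (- {0::'a}) (\<lambda>x. ln (norm x))" by (intro continuous_intros) auto
  note comp = continuous_on_compose2[OF _ cl, of UNIV]
  have "continuous_on (- {0}) u"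
    by (subst continuous_on_cong[OF refl, of _ u "\<lambda>x. F (ln (norm x))"]) (auto simp: u intro: comp cF)
  moreover have "continuous_on (- {0}) (partial_deriv i u)" if "i \<in> Basis" for i
    by (subst continuous_on_cong[OF refl, of _ _ "\<lambda>x. K (ln (norm x)) * (x \<bullet> i)"])
      (use that in \<open>auto simp: p1 intro!: continuous_intros comp cK\<close>)
  moreover have "continuous_on (- {0}) (partial_deriv j (partial_deriv i u))" if "i \<in> Basis" "j \<in> Basis" for i j
    by (subst continuous_on_cong[OF refl, of _ _ "\<lambda>x. K' (ln (norm x)) * ((x \<bullet> j) / (norm x)\<^sup>2) * (x \<bullet> i) + K (ln (norm x)) * (j \<bullet> i)"])
      (use that in \<open>auto simp: p2 intro!: continuous_intros comp cK\<close>)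
  ultimately show "Ck_on 2 (- {0}) u"
    using d1 d2 by (fastforce simp: numeral_2_eq_2 field_differentiable_def)
  assume x: "x \<noteq> 0"
  have "laplacian u x = (\<Sum>i\<in>Basis. K' (ln (norm x)) / (norm x)\<^sup>2 * ((x \<bullet> i) * (x \<bullet> i)) + K (ln (norm x)))"
    unfolding laplacian_def using x by (intro sum.cong refl) (simp add: p2 inner_Basis)
  also have "\<dots> = K' (ln (norm x)) / (norm x)\<^sup>2 * (x \<bullet> x) + real DIM('a) * K (ln (norm x))"
    by (simp add: sum.distrib sum_distrib_left[symmetric] sum_divide_distrib[symmetric] euclidean_inner[of x x])
  also have "\<dots> = K' (ln (norm x)) + real DIM('a) * K (ln (norm x))"
    using x by (simp add: power2_norm_eq_inner)
  also have "\<dots> = (F'' (ln (norm x)) + (real DIM('a) - 2) * F' (ln (norm x))) / (norm x)\<^sup>2"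
    unfolding K_def K'_def exp2[OF x] using x by (simp add: field_simps)
  finally show "laplacian u x = (F'' (ln (norm x)) + (real DIM('a) - 2) * F' (ln (norm x))) / (norm x)\<^sup>2" .
qed

text \<open>The operator \<open>(d/dt - c)(d/dt + n - 2 - c)\<close>, as a function of the values of \<open>f\<close>, \<open>f'\<close> and \<open>f''\<close>. It represents
  the Laplacian in dimension \<open>n\<close>, up to the factor \<open>\<bar>x\<bar>\<^sup>-\<^sup>c\<^sup>-\<^sup>2\<close>, when a radial function is written as \<open>\<bar>x\<bar>\<^sup>-\<^sup>c f(ln \<bar>x\<bar>)\<close>.\<close>

definition lap_log :: "real \<Rightarrow> real \<Rightarrow> real \<Rightarrow> real \<Rightarrow> real \<Rightarrow> real" where
  "lap_log n c f0 f1 f2 = f2 + (n - 2 - 2 * c) * f1 + (c\<^sup>2 - (n - 2) * c) * f0"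

lemma norm_powr_exp: "x \<noteq> 0 \<Longrightarrow> norm x powr c = exp (c * ln (norm x))"
  by (simp add: powr_def)

lemma emden_fowler_Ck_laplacian:
  fixes u :: "'a::euclidean_space \<Rightarrow> real"
  assumes f: "\<And>t. (f has_real_derivative f' t) (at t)" and f': "\<And>t. (f' has_real_derivative f'' t) (at t)"
    and f'': "continuous_on UNIV f''" and u: "\<And>x. x \<noteq> 0 \<Longrightarrow> u x = norm x powr (- c) * f (ln (norm x))"
  shows "Ck_on 2 (- {0}) u"
    and "x \<noteq> 0 \<Longrightarrow> laplacian u x = norm x powr (- (c + 2)) *
        lap_log (real DIM('a)) c (f (ln (norm x))) (f' (ln (norm x))) (f'' (ln (norm x)))"
proof -
  define F where "F t = exp (- c * t) * f t" for t
  define F' where "F' t = exp (- c * t) * (f' t - c * f t)" for t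
  define F'' where "F'' t = exp (- c * t) * (f'' t - 2 * c * f' t + c\<^sup>2 * f t)" for t
  have F: "(F has_real_derivative F' t) (at t)" for t
    unfolding F_def F'_def by (auto intro!: derivative_eq_intros f simp: algebra_simps)
  have F': "(F' has_real_derivative F'' t) (at t)" for t
    unfolding F'_def F''_def by (auto intro!: derivative_eq_intros f f' simp: algebra_simps power2_eq_square)
  have cf: "continuous_on UNIV f" "continuous_on UNIV f'"
    using f f' by (meson DERIV_isCont continuous_at_imp_continuous_on)+
  have F'': "continuous_on UNIV F''"
    unfolding F''_def by (intro continuous_intros cf f'')
  have uF: "u x = F (ln (norm x))" if "x \<noteq> 0" for x
    using that by (simp add: u F_def norm_powr_exp)
  note * = radial_profile_Ck_laplacian[OF F F' F'' uF]
  show "Ck_on 2 (- {0}) u" by (rule *(1))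
  assume x: "x \<noteq> 0"
  have lap: "laplacian u x = (F'' (ln (norm x)) + (real DIM('a) - 2) * F' (ln (norm x))) / (norm x)\<^sup>2"
    by (rule *(2)) (use x in auto)
  have "norm x powr (- (c + 2)) = exp (- c * ln (norm x)) / (norm x)\<^sup>2"
  proof -
    have "norm x powr (- (c + 2)) = norm x powr (- c) / norm x powr 2"
      using x by (simp add: powr_diff)
    then show ?thesis using x by (simp add: norm_powr_exp[of x "- c"])
  qed
  then show "laplacian u x = norm x powr (- (c + 2)) *
        lap_log (real DIM('a)) c (f (ln (norm x))) (f' (ln (norm x))) (f'' (ln (norm x)))"
    using lap by (simp add: F'_def F''_def lap_log_def algebra_simps power2_eq_square add_divide_distrib diff_divide_distrib)
qed

section \<open>Integration of radial functions\<close>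

text \<open>Both measures are determined by the volumes of balls. The minus sign makes the half-lines
  \<open>{s<..}\<close> correspond to balls, which have finite measure.\<close>

lemma distr_minus_ln_norm:
  defines "d \<equiv> real DIM('a::euclidean_space)"
  defines "V \<equiv> measure lborel (ball (0::'a) 1)"
  shows "distr lborel borel (\<lambda>x::'a. - ln (norm x)) = density lborel (\<lambda>t. ennreal (d * V * exp (- d * t)))"
    (is "?M = ?N")
proof -
  have d: "0 < d" by (simp add: d_def)
  have V: "0 \<le> V" by (simp add: V_def)
  have M: "emeasure ?M {s<..} = ennreal (V * exp (- d * s))" for s
  proof -
    have "emeasure ?M {s<..} = emeasure lborel {x::'a. s < - ln (norm x)}"
      by (subst emeasure_distr) (auto intro!: arg_cong[where f = "emeasure lborel"])
    also have "\<dots> = emeasure lborel (ball (0::'a) (exp (- s)))"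
    proof (rule emeasure_eq_AE)
      have "s < - ln (norm x) \<longleftrightarrow> norm x < exp (- s)" if "x \<noteq> 0" for x :: 'a
      proof -
        have "norm x < exp (- s) \<longleftrightarrow> ln (norm x) < - s" using that by (metis exp_gt_zero ln_exp ln_less_cancel_iff zero_less_norm_iff)
        then show ?thesis by linarith
      qed
      then show "AE x in (lborel::'a measure). (x \<in> {x. s < - ln (norm x)}) = (x \<in> ball 0 (exp (- s)))"
        using AE_lborel_singleton[of "0::'a"] by (auto elim!: eventually_mono)
    qed auto
    also have "\<dots> = ennreal (V * exp (- d * s))"
    proof -
      have "V = unit_ball_vol d"
        unfolding V_def d_def using content_ball[of 1 "0::'a"] by simp
      moreover have "emeasure lborel (ball (0::'a) (exp (- s))) = ennreal (unit_ball_vol d * exp (- s) ^ DIM('a))"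
        unfolding d_def by (rule emeasure_ball) simp
      moreover have "exp (- s) ^ DIM('a) = exp (- d * s)"
        by (simp add: d_def exp_of_nat_mult[symmetric])
      ultimately show ?thesis by simp
    qed
    finally show ?thesis .
  qed
  have N: "emeasure ?N {s<..} = ennreal (V * exp (- d * s))" for s
  proof -
    have "emeasure ?N {s<..} = (\<integral>\<^sup>+t. ennreal (d * V * exp (- d * t)) * indicator {s<..} t \<partial>lborel)"
      by (subst emeasure_density) auto
    also have "\<dots> = (\<integral>\<^sup>+t. ennreal (d * V * exp (- d * t)) * indicator {s..} t \<partial>lborel)"
      by (intro nn_integral_cong_AE eventually_mono[OF AE_lborel_singleton[of s]]) (auto simp: indicator_def)
    also have "\<dots> = ennreal (0 - (- V * exp (- d * s)))"
    proof (rule nn_integral_FTC_atLeast)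
      show "((\<lambda>t. - V * exp (- d * t)) has_real_derivative d * V * exp (- d * x)) (at x)" for x
        by (auto intro!: derivative_eq_intros)
      have "((\<lambda>t. exp (- d * t)) \<longlongrightarrow> 0) at_top"
        using d by (intro filterlim_compose[OF exp_at_bot] filterlim_tendsto_neg_mult_at_bot
          [OF tendsto_const]) (auto simp: filterlim_ident)
      from tendsto_mult_right_zero[OF this, of "- V"] show "((\<lambda>t. - V * exp (- d * t)) \<longlongrightarrow> 0) at_top" .
    qed (use d V in auto)
    finally show ?thesis by simp
  qed
  show ?thesis
  proof (rule measure_eqI_lessThan)
    show "emeasure ?M {s<..} < \<infinity>" "emeasure ?M {s<..} = emeasure ?N {s<..}" for s
      by (simp_all only: M N) simp
  qed auto
qed

lemma radial_integral:
  fixes G :: "real \<Rightarrow> real"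
  assumes [measurable]: "G \<in> borel_measurable borel"
  shows "integrable lborel (\<lambda>x::'a::euclidean_space. G (ln (norm x))) \<longleftrightarrow>
      integrable lborel (\<lambda>t. exp (real DIM('a) * t) * G t)"
    and "(\<integral>(x::'a). G (ln (norm x)) \<partial>lborel) =
      real DIM('a) * measure lborel (ball (0::'a) 1) * (\<integral>t. exp (real DIM('a) * t) * G t \<partial>lborel)"
proof -
  define c where "c = real DIM('a) * measure lborel (ball (0::'a) 1)"
  have c: "0 < c" using content_ball_pos[of 1 "0::'a"] by (simp add: c_def)
  define k where "k t = exp (real DIM('a) * t) * G t" for t
  note D = distr_minus_ln_norm[where 'a = 'a, folded c_def]
  have "integrable lborel (\<lambda>x::'a. G (ln (norm x))) \<longleftrightarrow>
      integrable (distr lborel borel (\<lambda>x::'a. - ln (norm x))) (\<lambda>t. G (- t))"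
    by (subst integrable_distr_eq) auto
  also have "\<dots> \<longleftrightarrow> integrable lborel (\<lambda>t. c * k (- t))"
    unfolding D using c by (subst integrable_density) (auto simp: k_def mult.assoc)
  also have "\<dots> \<longleftrightarrow> integrable lborel k"
    using lborel_integrable_real_affine_iff[of "-1" k 0] c by simp
  finally show "integrable lborel (\<lambda>x::'a::euclidean_space. G (ln (norm x))) \<longleftrightarrow>
      integrable lborel (\<lambda>t. exp (real DIM('a) * t) * G t)" by (simp add: k_def[abs_def])
  have "(\<integral>(x::'a). G (ln (norm x)) \<partial>lborel) =
      (\<integral>t. G (- t) \<partial>distr lborel borel (\<lambda>x::'a. - ln (norm x)))"
    by (subst integral_distr) auto
  also have "\<dots> = (\<integral>t. c * k (- t) \<partial>lborel)"
    unfolding D using c by (subst integral_density) (auto simp: k_def mult.assoc)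
  also have "\<dots> = c * (\<integral>t. k t \<partial>lborel)"
    using lborel_integral_real_affine[of "-1" k 0] by simp
  finally show "(\<integral>(x::'a). G (ln (norm x)) \<partial>lborel) =
      real DIM('a) * measure lborel (ball (0::'a) 1) * (\<integral>t. exp (real DIM('a) * t) * G t \<partial>lborel)"
    by (simp add: c_def k_def)
qed

text \<open>For this weight the powers of \<open>\<bar>x\<bar>\<close> cancel against the volume element, and the weighted norm is a
  multiple of the plain \<open>L\<^sup>\<theta>\<close> norm of the profile.\<close>

lemma weighted_log_profile:
  fixes U :: "'a::euclidean_space \<Rightarrow> real"
  assumes w [measurable]: "w \<in> borel_measurable borel"
    and U: "\<And>x. x \<noteq> 0 \<Longrightarrow> U x = norm x powr (- c) * w (ln (norm x))"
    and \<beta>: "\<beta> = c * \<theta> - real DIM('a)"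
  shows "U \<in> weighted_L \<theta> \<beta> \<longleftrightarrow> integrable lborel (\<lambda>t. \<bar>w t\<bar> powr \<theta>)"
    and "weighted_norm \<theta> \<beta> U =
      (real DIM('a) * measure lborel (ball (0::'a) 1) * (\<integral>t. \<bar>w t\<bar> powr \<theta> \<partial>lborel)) powr (1 / \<theta>)"
proof -
  define G where "G t = exp ((\<beta> - c * \<theta>) * t) * \<bar>w t\<bar> powr \<theta>" for t
  have [measurable]: "G \<in> borel_measurable borel" unfolding G_def by measurable
  have U': "U = (\<lambda>x. if x = 0 then U 0 else norm x powr (- c) * w (ln (norm x)))"
    using U by auto
  have mU [measurable]: "U \<in> borel_measurable borel"
    by (subst U') measurable
  have "norm x powr \<beta> * \<bar>U x\<bar> powr \<theta> = G (ln (norm x))" if x: "x \<noteq> 0" for x :: 'a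
    using x by (simp add: U G_def abs_mult powr_mult powr_powr mult.assoc[symmetric] powr_add[symmetric])
      (simp add: norm_powr_exp)
  then have AE: "AE x in (lborel::'a measure). norm x powr \<beta> * \<bar>U x\<bar> powr \<theta> = G (ln (norm x))"
    using AE_lborel_singleton[of "0::'a"] by (auto elim!: eventually_mono)
  have G: "exp (real DIM('a) * t) * G t = \<bar>w t\<bar> powr \<theta>" for t
    unfolding G_def \<beta> by (simp add: mult.assoc[symmetric] exp_add[symmetric])
  have "U \<in> weighted_L \<theta> \<beta> \<longleftrightarrow> integrable lborel (\<lambda>x. norm x powr \<beta> * \<bar>U x\<bar> powr \<theta>)"
    unfolding weighted_L_def by (simp add: integrable_completion measurable_completion)
  also have "\<dots> \<longleftrightarrow> integrable lborel (\<lambda>x::'a. G (ln (norm x)))"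
    by (intro integrable_cong_AE AE) measurable
  also have "\<dots> \<longleftrightarrow> integrable lborel (\<lambda>t. \<bar>w t\<bar> powr \<theta>)"
    by (subst radial_integral(1)) (auto simp: G)
  finally show "U \<in> weighted_L \<theta> \<beta> \<longleftrightarrow> integrable lborel (\<lambda>t. \<bar>w t\<bar> powr \<theta>)" .
  have "(LINT x|lebesgue. norm x powr \<beta> * \<bar>U x\<bar> powr \<theta>) = (\<integral>x. norm x powr \<beta> * \<bar>U x\<bar> powr \<theta> \<partial>lborel)"
    by (intro integral_completion) measurable
  also have "\<dots> = (\<integral>(x::'a). G (ln (norm x)) \<partial>lborel)"
    by (intro integral_cong_AE AE) measurable
  also have "\<dots> = real DIM('a) * measure lborel (ball (0::'a) 1) * (\<integral>t. \<bar>w t\<bar> powr \<theta> \<partial>lborel)"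
    by (subst radial_integral(2)) (auto simp: G)
  finally show "weighted_norm \<theta> \<beta> U =
      (real DIM('a) * measure lborel (ball (0::'a) 1) * (\<integral>t. \<bar>w t\<bar> powr \<theta> \<partial>lborel)) powr (1 / \<theta>)"
    by (simp add: weighted_norm_def)
qed

section \<open>A twice differentiable cut-off function\<close>

lemma DERIV_max_power:
  "((\<lambda>z::real. max 0 z ^ Suc (Suc k)) has_real_derivative real (Suc (Suc k)) * max 0 z ^ Suc k) (at z)"
proof (cases z "0::real" rule: linorder_cases)
  case less
  have "((\<lambda>z::real. 0) has_real_derivative 0) (at z)" by simp
  then have "((\<lambda>z::real. max 0 z ^ Suc (Suc k)) has_real_derivative 0) (at z)"
    by (rule has_field_derivative_transform_within_open[of _ _ _ "{..<0}"]) (use less in auto)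
  then show ?thesis using less by simp
next
  case greater
  have "((\<lambda>z::real. z ^ Suc (Suc k)) has_real_derivative real (Suc (Suc k)) * z ^ Suc k) (at z)"
    using DERIV_pow[of "Suc (Suc k)" z UNIV] by simp
  then have "((\<lambda>z::real. max 0 z ^ Suc (Suc k)) has_real_derivative real (Suc (Suc k)) * z ^ Suc k) (at z)"
    by (rule has_field_derivative_transform_within_open[of _ _ _ "{0<..}"]) (use greater in auto)
  then show ?thesis using greater by simp
next
  case equal
  have "((\<lambda>y. (max 0 y ^ Suc (Suc k) - max 0 0 ^ Suc (Suc k)) / (y - 0)) \<longlongrightarrow> 0) (at (0::real))"
  proof (rule Lim_null_comparison)
    show "\<forall>\<^sub>F y::real in at 0. norm ((max 0 y ^ Suc (Suc k) - max 0 0 ^ Suc (Suc k)) / (y - 0)) \<le> \<bar>y\<bar> ^ Suc k"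
      by (intro always_eventually allI) (auto simp: max_def abs_mult power_abs mult_nonpos_nonneg)
    show "((\<lambda>y::real. \<bar>y\<bar> ^ Suc k) \<longlongrightarrow> 0) (at 0)"
      by (auto intro!: tendsto_eq_intros)
  qed
  then show ?thesis using equal by (simp add: has_field_derivative_iff)
qed

text \<open>A function equal to \<open>1\<close> at \<open>0\<close> and supported in \<open>[-1, 1]\<close>, with its first two derivatives.\<close>

definition bump :: "real \<Rightarrow> real" where "bump t = max 0 (1 - t\<^sup>2) ^ 3"
definition bump' :: "real \<Rightarrow> real" where "bump' t = - 6 * t * max 0 (1 - t\<^sup>2) ^ 2"
definition bump'' :: "real \<Rightarrow> real" where
  "bump'' t = - 6 * max 0 (1 - t\<^sup>2) ^ 2 + 24 * t\<^sup>2 * max 0 (1 - t\<^sup>2)"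

lemma one_minus_square_DERIV: "((\<lambda>t::real. 1 - t\<^sup>2) has_real_derivative - 2 * t) (at t)"
  by (auto intro!: derivative_eq_intros)

lemma bump_DERIV: "(bump has_real_derivative bump' t) (at t)"
proof -
  have "((\<lambda>t. max 0 (1 - t\<^sup>2) ^ 3) has_real_derivative (3 * max 0 (1 - t\<^sup>2) ^ 2) * (- 2 * t)) (at t)"
    using DERIV_chain2[where f = "\<lambda>z. max 0 z ^ Suc (Suc 1)" and g = "\<lambda>t. 1 - t\<^sup>2" and x = t,
        OF DERIV_max_power one_minus_square_DERIV]
    by (simp add: eval_nat_numeral)
  then show ?thesis by (simp add: bump_def[abs_def] bump'_def algebra_simps)
qed

lemma bump'_DERIV: "(bump' has_real_derivative bump'' t) (at t)"
proof -
  have "((\<lambda>t. max 0 (1 - t\<^sup>2) ^ 2) has_real_derivative (2 * max 0 (1 - t\<^sup>2)) * (- 2 * t)) (at t)"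
    using DERIV_chain2[where f = "\<lambda>z. max 0 z ^ Suc (Suc 0)" and g = "\<lambda>t. 1 - t\<^sup>2" and x = t,
        OF DERIV_max_power one_minus_square_DERIV]
    by (simp add: eval_nat_numeral)
  from DERIV_mult[OF DERIV_cmult_Id[of "- 6"] this] show ?thesis
    by (simp add: bump'_def[abs_def] bump''_def algebra_simps power2_eq_square)
qed

lemma bump''_continuous: "continuous_on UNIV bump''"
  unfolding bump''_def[abs_def] by (intro continuous_intros)

lemma bump_bounds: "\<bar>bump t\<bar> \<le> 1" "\<bar>bump' t\<bar> \<le> 6" "\<bar>bump'' t\<bar> \<le> 30" and bump_outside: "1 \<le> \<bar>t\<bar> \<Longrightarrow> bump t = 0"
proof -
  define z where "z = max 0 (1 - t\<^sup>2)"
  have z: "0 \<le> z" "z \<le> 1" by (auto simp: z_def)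
  have out: "z = 0" if "1 \<le> \<bar>t\<bar>"
    using that power_mono[OF that, of 2] by (simp add: z_def)
  then show "1 \<le> \<bar>t\<bar> \<Longrightarrow> bump t = 0" by (simp add: bump_def z_def[symmetric])
  have t: "\<bar>t\<bar> \<le> 1" if "z \<noteq> 0" using out that by linarith
  have z2: "0 \<le> z\<^sup>2" "z\<^sup>2 \<le> 1" using z by (auto simp: power_le_one)
  show "\<bar>bump t\<bar> \<le> 1" unfolding bump_def z_def[symmetric] using z by (simp add: power_le_one)
  show "\<bar>bump' t\<bar> \<le> 6"
  proof (cases "z = 0")
    case False
    have "\<bar>t\<bar> * z\<^sup>2 \<le> 1 * 1" using t[OF False] z2 by (intro mult_mono) auto
    then show ?thesis unfolding bump'_def z_def[symmetric] by (simp add: abs_mult)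
  qed (simp add: bump'_def z_def[symmetric])
  show "\<bar>bump'' t\<bar> \<le> 30"
  proof (cases "z = 0")
    case False
    have "t\<^sup>2 \<le> 1" using t[OF False] abs_square_le_1 by blast
    then have "t\<^sup>2 * z \<le> 1 * 1" using z by (intro mult_mono) auto
    moreover have "0 \<le> t\<^sup>2 * z" using z by simp
    ultimately show ?thesis unfolding bump''_def z_def[symmetric] abs_le_iff mult.assoc using z2 by linarith
  qed (simp add: bump''_def z_def[symmetric])
qed

section \<open>Membership in the completed Sobolev space\<close>

lemma powr_sum_le:
  fixes a b :: real
  assumes "0 \<le> a" "0 \<le> b" "0 \<le> r"
  shows "(a + b) powr r \<le> 2 powr r * (a powr r + b powr r)"
proof -
  have "(a + b) powr r \<le> (2 * max a b) powr r" using assms by (intro powr_mono2) auto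
  also have "\<dots> = 2 powr r * max a b powr r" using assms by (simp add: powr_mult)
  also have "\<dots> \<le> 2 powr r * (a powr r + b powr r)"
    by (intro mult_left_mono) (auto simp: max_def)
  finally show ?thesis .
qed

lemma integrable_powr_add:
  fixes f g :: "real \<Rightarrow> real"
  assumes "0 \<le> r" and [measurable]: "f \<in> borel_measurable borel" "g \<in> borel_measurable borel"
    and f: "integrable lborel (\<lambda>t. \<bar>f t\<bar> powr r)" and g: "integrable lborel (\<lambda>t. \<bar>g t\<bar> powr r)"
  shows "integrable lborel (\<lambda>t. (\<bar>f t\<bar> + \<bar>g t\<bar>) powr r)"
proof (rule Bochner_Integration.integrable_bound)
  show "integrable lborel (\<lambda>t. 2 powr r * (\<bar>f t\<bar> powr r + \<bar>g t\<bar> powr r))" using f g by simp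
  show "AE t in lborel. norm ((\<bar>f t\<bar> + \<bar>g t\<bar>) powr r) \<le> norm (2 powr r * (\<bar>f t\<bar> powr r + \<bar>g t\<bar> powr r))"
    using powr_sum_le assms(1) by (intro AE_I2) simp
qed measurable

lemma dominated_powr_limit:
  fixes h :: "nat \<Rightarrow> real \<Rightarrow> real"
  assumes [measurable]: "\<And>k. h k \<in> borel_measurable borel" "H \<in> borel_measurable borel"
    and lim: "\<And>t. (\<lambda>k. h k t) \<longlonglongrightarrow> 0" and le: "\<And>k t. \<bar>h k t\<bar> \<le> H t"
    and int: "integrable lborel (\<lambda>t. H t powr r)" and r: "0 < r"
  shows "integrable lborel (\<lambda>t. \<bar>h k t\<bar> powr r)"
    "(\<lambda>k. \<integral>t. \<bar>h k t\<bar> powr r \<partial>lborel) \<longlonglongrightarrow> 0"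
proof -
  have b: "\<bar>h k t\<bar> powr r \<le> H t powr r" for k t
    using le r by (intro powr_mono2) auto
  show "integrable lborel (\<lambda>t. \<bar>h k t\<bar> powr r)"
    by (rule Bochner_Integration.integrable_bound[OF int]) (use b in auto)
  have "(\<lambda>k. \<integral>t. \<bar>h k t\<bar> powr r \<partial>lborel) \<longlonglongrightarrow> (\<integral>t. 0 \<partial>(lborel :: real measure))"
  proof (rule integral_dominated_convergence[OF _ _ int])
    show "AE t in lborel. (\<lambda>k. \<bar>h k t\<bar> powr r) \<longlonglongrightarrow> 0"
    proof (rule AE_I2)
      fix t
      have "(\<lambda>k. \<bar>h k t\<bar> powr r) \<longlonglongrightarrow> 0 powr r"
        by (rule tendsto_powr'[OF tendsto_rabs_zero[OF lim] tendsto_const]) (use r in auto)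
      then show "(\<lambda>k. \<bar>h k t\<bar> powr r) \<longlonglongrightarrow> 0" by simp
    qed
  qed (use b in auto)
  then show "(\<lambda>k. \<integral>t. \<bar>h k t\<bar> powr r \<partial>lborel) \<longlonglongrightarrow> 0" by simp
qed

text \<open>The approximating functions have the profiles \<open>f(t) bump(t / (k + 1))\<close>. Their derivatives up to order two
  converge pointwise to those of \<open>f\<close> under a common \<open>L\<^sup>\<theta>\<close> majorant, so dominated convergence gives
  convergence in both norms.\<close>

lemma D2_rad_emden_fowler:
  fixes u :: "'a::euclidean_space \<Rightarrow> real"
  assumes f: "\<And>t. (f has_real_derivative f' t) (at t)" and f': "\<And>t. (f' has_real_derivative f'' t) (at t)"
    and f'': "continuous_on UNIV f''" and u: "\<And>x. x \<noteq> 0 \<Longrightarrow> u x = norm x powr (- c) * f (ln (norm x))"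
    and \<theta>: "1 < \<theta>" and \<alpha>: "\<alpha> = (c + 2) * \<theta> - real DIM('a)"
    and if0: "integrable lborel (\<lambda>t. \<bar>f t\<bar> powr \<theta>)" and if1: "integrable lborel (\<lambda>t. \<bar>f' t\<bar> powr \<theta>)"
    and if2: "integrable lborel (\<lambda>t. \<bar>f'' t\<bar> powr \<theta>)"
  shows "u \<in> D2_rad \<theta> \<alpha>"
proof -
  define d where "d = real DIM('a)"
  define V where "V = d * measure lborel (ball (0::'a) 1)"
  have V: "0 < V" using content_ball_pos[of 1 "0::'a"] by (simp add: V_def d_def)
  have cf: "continuous_on UNIV f" "continuous_on UNIV f'"
    using f f' by (meson DERIV_isCont continuous_at_imp_continuous_on)+
  note [measurable] = borel_measurable_continuous_onI[OF cf(1)] borel_measurable_continuous_onI[OF cf(2)]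
    borel_measurable_continuous_onI[OF f'']
  define e where "e k = 1 / real (Suc k)" for k
  have e: "0 < e k" "e k \<le> 1" for k by (auto simp: e_def)
  have e_lim: "e \<longlonglongrightarrow> 0" unfolding e_def using LIMSEQ_Suc[OF lim_1_over_n] .
  define b0 where "b0 k t = bump (e k * t)" for k t
  define b1 where "b1 k t = e k * bump' (e k * t)" for k t
  define b2 where "b2 k t = e k * (e k * bump'' (e k * t))" for k t
  have db0: "(b0 k has_real_derivative b1 k t) (at t)" for k t
    unfolding b0_def b1_def using DERIV_chain2[OF bump_DERIV DERIV_cmult_Id[of "e k" t]]
    by (simp add: mult.commute)
  have db1: "(b1 k has_real_derivative b2 k t) (at t)" for k t
    unfolding b1_def b2_def using DERIV_cmult[OF DERIV_chain2[OF bump'_DERIV DERIV_cmult_Id[of "e k" t]], of "e k"]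
    by (simp add: mult.commute)
  have cb2: "continuous_on UNIV (b2 k)" for k
    unfolding b2_def by (intro continuous_intros continuous_on_compose2[OF bump''_continuous]) auto
  have bb: "\<bar>b0 k t\<bar> \<le> 1" "\<bar>b1 k t\<bar> \<le> 6" "\<bar>b2 k t\<bar> \<le> 30" for k t
  proof -
    show "\<bar>b0 k t\<bar> \<le> 1" by (simp add: b0_def bump_bounds)
    have "e k * \<bar>bump' (e k * t)\<bar> \<le> 1 * 6" using e[of k] bump_bounds by (intro mult_mono) auto
    then show "\<bar>b1 k t\<bar> \<le> 6" using e[of k] by (simp add: b1_def abs_mult)
    have "e k * (e k * \<bar>bump'' (e k * t)\<bar>) \<le> 1 * (1 * 30)" using e[of k] bump_bounds
      by (intro mult_mono) auto
    then show "\<bar>b2 k t\<bar> \<le> 30" using e[of k] by (simp add: b2_def abs_mult)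
  qed
  have eb_lim: "(\<lambda>k. e k * y k) \<longlonglongrightarrow> 0" if "\<And>k. \<bar>y k\<bar> \<le> C" for y C
  proof (rule Lim_null_comparison)
    show "\<forall>\<^sub>F k in sequentially. norm (e k * y k) \<le> e k * C"
      using that e by (intro always_eventually allI) (simp add: abs_mult less_imp_le)
    show "(\<lambda>k. e k * C) \<longlonglongrightarrow> 0" using tendsto_mult_left_zero[OF e_lim] .
  qed
  have b_lim: "(\<lambda>k. b0 k t) \<longlonglongrightarrow> 1" "(\<lambda>k. b1 k t) \<longlonglongrightarrow> 0" "(\<lambda>k. b2 k t) \<longlonglongrightarrow> 0" for t
  proof -
    have "(\<lambda>k. e k * t) \<longlonglongrightarrow> 0" using tendsto_mult_left_zero[OF e_lim] .
    from isCont_tendsto_compose[OF DERIV_isCont[OF bump_DERIV] this]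
    show "(\<lambda>k. b0 k t) \<longlonglongrightarrow> 1" by (simp add: b0_def bump_def)
    show "(\<lambda>k. b1 k t) \<longlonglongrightarrow> 0"
      unfolding b1_def using bump_bounds(2) by (rule eb_lim)
    show "(\<lambda>k. b2 k t) \<longlonglongrightarrow> 0"
      unfolding b2_def
    proof (rule eb_lim)
      show "\<bar>e k * bump'' (e k * t)\<bar> \<le> 1 * 30" for k
        unfolding abs_mult using e[of k] bump_bounds(3) by (intro mult_mono) auto
    qed
  qed
  have cb: "continuous_on UNIV (b0 k)" "continuous_on UNIV (b1 k)" for k
    using db0 db1 by (meson DERIV_isCont continuous_at_imp_continuous_on)+
  define w0 where "w0 k t = f t * b0 k t" for k t
  define w1 where "w1 k t = f' t * b0 k t + f t * b1 k t" for k t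
  define w2 where "w2 k t = f'' t * b0 k t + 2 * (f' t * b1 k t) + f t * b2 k t" for k t
  have dw0: "(w0 k has_real_derivative w1 k t) (at t)" for k t
    unfolding w0_def w1_def by (auto intro!: derivative_eq_intros f db0)
  have dw1: "(w1 k has_real_derivative w2 k t) (at t)" for k t
    unfolding w1_def w2_def by (auto intro!: derivative_eq_intros f f' db0 db1)
  have cw: "continuous_on UNIV (w0 k)" "continuous_on UNIV (w1 k)" "continuous_on UNIV (w2 k)" for k
    unfolding w0_def w1_def w2_def by (intro continuous_intros cf f'' cb cb2)+
  note [measurable] = borel_measurable_continuous_onI[OF cw(1)] borel_measurable_continuous_onI[OF cw(2)]
    borel_measurable_continuous_onI[OF cw(3)]
  define \<phi> where "\<phi> k x = norm x powr (- c) * w0 k (ln (norm x))" for k and x :: 'a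
  note \<phi>_Ck = emden_fowler_Ck_laplacian(1)[OF dw0 dw1 cw(3) \<phi>_def]

  have \<phi>_C2c: "\<phi> k \<in> radial_C2c" for k
  proof -
    define K where "K = {x::'a. exp (- 1 / e k) \<le> norm x \<and> norm x \<le> exp (1 / e k)}"
    have "x \<in> K" if "\<phi> k x \<noteq> 0" for x
    proof -
      from that have x: "x \<noteq> 0" and "bump (e k * ln (norm x)) \<noteq> 0"
        by (auto simp: \<phi>_def w0_def b0_def)
      then have "\<bar>e k * ln (norm x)\<bar> < 1" using bump_outside by force
      then have "- 1 / e k < ln (norm x)" "ln (norm x) < 1 / e k"
        using e[of k] by (auto simp: field_simps abs_less_iff)
      then show "x \<in> K" using x unfolding K_def
        by (metis (mono_tags, lifting) exp_le_cancel_iff exp_ln less_imp_le mem_Collect_eq zero_less_norm_iff)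
    qed
    then have sub: "{x. \<phi> k x \<noteq> 0} \<subseteq> K" by blast
    have "closed K" unfolding K_def by (intro closed_Collect_conj closed_Collect_le continuous_intros)
    then have cl: "closure {x. \<phi> k x \<noteq> 0} \<subseteq> K" using sub by (rule closure_minimal[rotated])
    have "bounded K" unfolding K_def bounded_iff by blast
    then have "compact (closure {x. \<phi> k x \<noteq> 0})"
      using cl bounded_subset compact_eq_bounded_closed by blast
    moreover have "0 \<notin> closure {x. \<phi> k x \<noteq> 0}" using cl by (auto simp: K_def)
    moreover have "radial (\<phi> k)" by (simp add: radial_def \<phi>_def)
    ultimately show ?thesis using \<phi>_Ck unfolding radial_C2c_def by blast
  qed

  define \<Lambda> where "\<Lambda> k t = lap_log d c (w0 k t) (w1 k t) (w2 k t)" for k t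
  define \<Lambda>' where "\<Lambda>' t = lap_log d c (f t) (f' t) (f'' t)" for t
  have [measurable]: "\<Lambda> k \<in> borel_measurable borel" "\<Lambda>' \<in> borel_measurable borel" for k
    unfolding \<Lambda>_def \<Lambda>'_def lap_log_def by measurable

  \<comment> \<open>\<open>100\<close> is a generous bound for the constants coming from the product rule\<close>
  define C where "C = 100 * (1 + \<bar>d - 2 - 2 * c\<bar> + \<bar>c\<^sup>2 - (d - 2) * c\<bar>)"
  define H where "H t = C * (\<bar>\<bar>f t\<bar> + \<bar>f' t\<bar>\<bar> + \<bar>f'' t\<bar>)" for t
  have C: "0 < C" unfolding C_def by (intro mult_pos_pos add_pos_nonneg) auto
  have [measurable]: "H \<in> borel_measurable borel" unfolding H_def by measurable
  have H: "integrable lborel (\<lambda>t. H t powr \<theta>)"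
  proof -
    have "integrable lborel (\<lambda>t. \<bar>\<bar>f t\<bar> + \<bar>f' t\<bar>\<bar> powr \<theta>)"
      using integrable_powr_add[OF _ _ _ if0 if1] \<theta> by simp
    then have "integrable lborel (\<lambda>t. (\<bar>\<bar>f t\<bar> + \<bar>f' t\<bar>\<bar> + \<bar>f'' t\<bar>) powr \<theta>)"
      using \<theta> by (intro integrable_powr_add if2) auto
    then show ?thesis unfolding H_def using C by (simp add: powr_mult)
  qed
  have \<Lambda>_lim: "(\<lambda>k. \<Lambda> k t - \<Lambda>' t) \<longlonglongrightarrow> 0" for t
  proof -
    have "(\<lambda>k. \<Lambda> k t - \<Lambda>' t) \<longlonglongrightarrow>
       lap_log d c (f t * 1) (f' t * 1 + f t * 0) (f'' t * 1 + 2 * (f' t * 0) + f t * 0) - \<Lambda>' t"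
      unfolding \<Lambda>_def w0_def w1_def w2_def lap_log_def by (intro tendsto_intros b_lim)
    then show ?thesis by (simp add: \<Lambda>'_def)
  qed
  have \<Lambda>_bound: "\<bar>\<Lambda> k t - \<Lambda>' t\<bar> \<le> H t" for k t
  proof -
    define A0 A1 A2 where A: "A0 = \<bar>f t\<bar>" "A1 = \<bar>f' t\<bar>" "A2 = \<bar>f'' t\<bar>"
    define S where "S = A0 + A1 + A2"
    have m: "\<bar>y * z\<bar> \<le> \<bar>y\<bar> * B" if "\<bar>z\<bar> \<le> B" for y z B :: real
      unfolding abs_mult using that by (intro mult_left_mono) auto
    have tri: "\<bar>x + y\<bar> \<le> A + B" "\<bar>x - y\<bar> \<le> A + B" if "\<bar>x\<bar> \<le> A" "\<bar>y\<bar> \<le> B" for x y A B :: real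
      using that by linarith+
    have A_nn: "0 \<le> A0" "0 \<le> A1" "0 \<le> A2" by (auto simp: A)
    have "\<bar>w0 k t - f t\<bar> \<le> \<bar>f t\<bar> * 1 + \<bar>f t\<bar>"
      unfolding w0_def by (intro tri m bb order_refl)
    then have w0: "\<bar>w0 k t - f t\<bar> \<le> 100 * S" using A_nn unfolding S_def A[symmetric] by (elim order_trans) simp
    have "\<bar>w1 k t - f' t\<bar> \<le> \<bar>f' t\<bar> * 1 + \<bar>f t\<bar> * 6 + \<bar>f' t\<bar>"
      unfolding w1_def by (intro tri m bb order_refl)
    then have w1: "\<bar>w1 k t - f' t\<bar> \<le> 100 * S" using A_nn unfolding S_def A[symmetric] by (elim order_trans) simp
    have "\<bar>w2 k t - f'' t\<bar> \<le> \<bar>f'' t\<bar> * 1 + \<bar>2\<bar> * (\<bar>f' t\<bar> * 6) + \<bar>f t\<bar> * 30 + \<bar>f'' t\<bar>"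
      unfolding w2_def by (intro tri m bb order_refl)
    then have w2: "\<bar>w2 k t - f'' t\<bar> \<le> 100 * S" using A_nn unfolding S_def A[symmetric] by (elim order_trans) simp
    have "\<Lambda> k t - \<Lambda>' t = (w2 k t - f'' t) + (d - 2 - 2 * c) * (w1 k t - f' t)
        + (c\<^sup>2 - (d - 2) * c) * (w0 k t - f t)"
      by (simp add: \<Lambda>_def \<Lambda>'_def lap_log_def algebra_simps)
    also have "\<bar>\<dots>\<bar> \<le> 100 * S + \<bar>d - 2 - 2 * c\<bar> * (100 * S) + \<bar>c\<^sup>2 - (d - 2) * c\<bar> * (100 * S)"
      by (intro tri(1) m w0 w1 w2)
    also have "\<dots> = H t" by (simp add: H_def C_def S_def A algebra_simps)
    finally show ?thesis .
  qed
  define E where "E k = (\<integral>t. \<bar>\<Lambda> k t - \<Lambda>' t\<bar> powr \<theta> \<partial>lborel)" for k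
  have iE: "integrable lborel (\<lambda>t. \<bar>\<Lambda> k t - \<Lambda>' t\<bar> powr \<theta>)" for k
    by (rule dominated_powr_limit(1)[OF _ _ \<Lambda>_lim \<Lambda>_bound H]) (use \<theta> in auto)
  have E_lim: "E \<longlonglongrightarrow> 0" unfolding E_def
    by (rule dominated_powr_limit(2)[OF _ _ \<Lambda>_lim \<Lambda>_bound H]) (use \<theta> in auto)
  have norm_eq: "D2_norm \<theta> \<alpha> (\<lambda>x. \<phi> j x - \<phi> k x) = (V * (\<integral>t. \<bar>\<Lambda> j t - \<Lambda> k t\<bar> powr \<theta> \<partial>lborel)) powr (1 / \<theta>)" for j k
    unfolding D2_norm_def V_def d_def
  proof (rule weighted_log_profile(2)[where c = "c + 2"])
    fix x :: 'a assume x: "x \<noteq> 0"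
    have "laplacian (\<lambda>x. \<phi> j x - \<phi> k x) x = norm x powr (- (c + 2)) * lap_log (real DIM('a)) c
       (w0 j (ln (norm x)) - w0 k (ln (norm x))) (w1 j (ln (norm x)) - w1 k (ln (norm x))) (w2 j (ln (norm x)) - w2 k (ln (norm x)))"
    proof (rule emden_fowler_Ck_laplacian(2)[OF _ _ _ _ x])
      show "((\<lambda>t. w0 j t - w0 k t) has_real_derivative w1 j t - w1 k t) (at t)" for t
        by (intro DERIV_diff dw0)
      show "((\<lambda>t. w1 j t - w1 k t) has_real_derivative w2 j t - w2 k t) (at t)" for t
        by (intro DERIV_diff dw1)
      show "continuous_on UNIV (\<lambda>t. w2 j t - w2 k t)" by (intro continuous_intros cw)
    qed (simp add: \<phi>_def right_diff_distrib)
    then show "laplacian (\<lambda>x. \<phi> j x - \<phi> k x) x = norm x powr (- (c + 2)) * (\<Lambda> j (ln (norm x)) - \<Lambda> k (ln (norm x)))"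
      by (simp add: \<Lambda>_def lap_log_def d_def algebra_simps)
  qed (use \<alpha> in auto)
  have diff_le: "(\<integral>t. \<bar>\<Lambda> j t - \<Lambda> k t\<bar> powr \<theta> \<partial>lborel) \<le> 2 powr \<theta> * (E j + E k)" for j k
  proof -
    have le: "\<bar>\<Lambda> j t - \<Lambda> k t\<bar> powr \<theta> \<le> 2 powr \<theta> * (\<bar>\<Lambda> j t - \<Lambda>' t\<bar> powr \<theta> + \<bar>\<Lambda> k t - \<Lambda>' t\<bar> powr \<theta>)" for t
    proof -
      have "\<bar>\<Lambda> j t - \<Lambda> k t\<bar> powr \<theta> \<le> (\<bar>\<Lambda> j t - \<Lambda>' t\<bar> + \<bar>\<Lambda> k t - \<Lambda>' t\<bar>) powr \<theta>"
        using \<theta> by (intro powr_mono2) auto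
      also have "\<dots> \<le> 2 powr \<theta> * (\<bar>\<Lambda> j t - \<Lambda>' t\<bar> powr \<theta> + \<bar>\<Lambda> k t - \<Lambda>' t\<bar> powr \<theta>)"
        using \<theta> by (intro powr_sum_le) auto
      finally show ?thesis .
    qed
    have i: "integrable lborel (\<lambda>t. 2 powr \<theta> * (\<bar>\<Lambda> j t - \<Lambda>' t\<bar> powr \<theta> + \<bar>\<Lambda> k t - \<Lambda>' t\<bar> powr \<theta>))"
      using iE by simp
    have i': "integrable lborel (\<lambda>t. \<bar>\<Lambda> j t - \<Lambda> k t\<bar> powr \<theta>)"
      by (rule Bochner_Integration.integrable_bound[OF i]) (use le in auto)
    have "(\<integral>t. \<bar>\<Lambda> j t - \<Lambda> k t\<bar> powr \<theta> \<partial>lborel) \<le> (\<integral>t. 2 powr \<theta> * (\<bar>\<Lambda> j t - \<Lambda>' t\<bar> powr \<theta> + \<bar>\<Lambda> k t - \<Lambda>' t\<bar> powr \<theta>) \<partial>lborel)"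
      by (intro integral_mono i i' le)
    also have "\<dots> = 2 powr \<theta> * (E j + E k)" using iE by (simp add: E_def)
    finally show ?thesis .
  qed
  have Cauchy: "\<exists>N. \<forall>j\<ge>N. \<forall>k\<ge>N. D2_norm \<theta> \<alpha> (\<lambda>x. \<phi> j x - \<phi> k x) < \<epsilon>" if \<epsilon>: "0 < \<epsilon>" for \<epsilon>
  proof -
    define \<delta> where "\<delta> = \<epsilon> powr \<theta> / (2 * V * 2 powr \<theta>)"
    have \<delta>: "0 < \<delta>" using \<epsilon> V by (simp add: \<delta>_def)
    obtain N where N: "\<And>k. k \<ge> N \<Longrightarrow> E k < \<delta>"
      using order_tendstoD(2)[OF E_lim \<delta>] unfolding eventually_sequentially by blast
    show ?thesis
    proof (intro exI allI impI)
      fix j k assume "j \<ge> N" "k \<ge> N"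
      then have "2 powr \<theta> * (E j + E k) < 2 powr \<theta> * (\<delta> + \<delta>)"
        using N by (intro mult_strict_left_mono add_strict_mono) auto
      then have "V * (\<integral>t. \<bar>\<Lambda> j t - \<Lambda> k t\<bar> powr \<theta> \<partial>lborel) < V * (2 powr \<theta> * (\<delta> + \<delta>))"
        by (rule mult_strict_left_mono[OF order.strict_trans1[OF diff_le] V])
      also have "\<dots> = \<epsilon> powr \<theta>" using V by (simp add: \<delta>_def)
      finally have "(V * (\<integral>t. \<bar>\<Lambda> j t - \<Lambda> k t\<bar> powr \<theta> \<partial>lborel)) powr (1 / \<theta>) < (\<epsilon> powr \<theta>) powr (1 / \<theta>)"
        using V \<theta> by (intro powr_less_mono2 mult_nonneg_nonneg integral_nonneg_AE) auto
      then show "D2_norm \<theta> \<alpha> (\<lambda>x. \<phi> j x - \<phi> k x) < \<epsilon>"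
        unfolding norm_eq using \<theta> \<epsilon> by (simp add: powr_powr)
    qed
  qed

  have \<beta>: "\<alpha> - 2 * \<theta> = c * \<theta> - real DIM('a)" by (simp add: \<alpha> algebra_simps)
  have uL: "u \<in> weighted_L \<theta> (\<alpha> - 2 * \<theta>)"
    using weighted_log_profile(1)[OF _ u \<beta>] if0 by simp
  have "weighted_norm \<theta> (\<alpha> - 2 * \<theta>) (\<lambda>x. \<phi> k x - u x) =
      (V * (\<integral>t. \<bar>w0 k t - f t\<bar> powr \<theta> \<partial>lborel)) powr (1 / \<theta>)" for k
    unfolding V_def d_def
    by (rule weighted_log_profile(2)[OF _ _ \<beta>]) (auto simp: \<phi>_def u right_diff_distrib)
  moreover have "(\<lambda>k. (V * (\<integral>t. \<bar>w0 k t - f t\<bar> powr \<theta> \<partial>lborel)) powr (1 / \<theta>)) \<longlonglongrightarrow> (V * 0) powr (1 / \<theta>)"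
  proof (rule tendsto_powr'[OF tendsto_mult[OF tendsto_const] tendsto_const])
    show "(\<lambda>k. \<integral>t. \<bar>w0 k t - f t\<bar> powr \<theta> \<partial>lborel) \<longlonglongrightarrow> 0"
    proof (rule dominated_powr_limit(2)[where H = "\<lambda>t. 2 * \<bar>f t\<bar>"])
      show "(\<lambda>k. w0 k t - f t) \<longlonglongrightarrow> 0" for t
        unfolding w0_def using tendsto_diff[OF tendsto_mult[OF tendsto_const b_lim(1)] tendsto_const, of "f t" t "f t"] by simp
      show "\<bar>w0 k t - f t\<bar> \<le> 2 * \<bar>f t\<bar>" for k t
      proof -
        have "\<bar>f t * b0 k t\<bar> \<le> \<bar>f t\<bar> * 1" unfolding abs_mult using bb(1) by (intro mult_left_mono) auto
        then show ?thesis unfolding w0_def by linarith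
      qed
      show "integrable lborel (\<lambda>t. (2 * \<bar>f t\<bar>) powr \<theta>)" using if0 by (simp add: powr_mult)
    qed (use \<theta> in auto)
    show "V * 0 \<noteq> 0 \<or> 0 < 1 / \<theta> \<and> (\<forall>\<^sub>F k in sequentially. 0 \<le> V * (\<integral>t. \<bar>w0 k t - f t\<bar> powr \<theta> \<partial>lborel))"
      using \<theta> V by (auto intro!: always_eventually integral_nonneg_AE)
  qed
  ultimately have "(\<lambda>k. weighted_norm \<theta> (\<alpha> - 2 * \<theta>) (\<lambda>x. \<phi> k x - u x)) \<longlonglongrightarrow> 0" by simp
  then show ?thesis unfolding D2_rad_def using uL \<phi>_C2c Cauchy by blast
qed

section \<open>Solutions of the system\<close>

lemma integrable_abs_powr_nonneg_Cb:
  "nonneg_Cb h \<Longrightarrow> integrable lborel (\<lambda>t. h t powr r) \<Longrightarrow> integrable lborel (\<lambda>t. \<bar>h t\<bar> powr r)"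
  using nonneg_Cb_nonneg[of h] by simp

lemma integrable_abs_powr_lincomb:
  fixes f g :: "real \<Rightarrow> real"
  assumes "0 \<le> r" "f \<in> borel_measurable borel" "g \<in> borel_measurable borel"
    and f: "integrable lborel (\<lambda>t. \<bar>f t\<bar> powr r)" and g: "integrable lborel (\<lambda>t. \<bar>g t\<bar> powr r)"
  shows "integrable lborel (\<lambda>t. \<bar>x * f t + y * g t\<bar> powr r)"
proof (rule Bochner_Integration.integrable_bound)
  note [measurable] = assms(2,3)
  show "integrable lborel (\<lambda>t. (\<bar>x * f t\<bar> + \<bar>y * g t\<bar>) powr r)"
    using f g assms(1) by (intro integrable_powr_add) (auto simp: abs_mult powr_mult)
  show "(\<lambda>t. \<bar>x * f t + y * g t\<bar> powr r) \<in> borel_measurable lborel" by measurable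
  show "AE t in lborel. norm (\<bar>x * f t + y * g t\<bar> powr r) \<le> norm ((\<bar>x * f t\<bar> + \<bar>y * g t\<bar>) powr r)"
    using assms(1) by (auto intro!: powr_mono2)
qed

text \<open>The convolution solves the second order equation by construction. Since \<open>f\<close>, \<open>f'\<close> and \<open>f''\<close> are
  linear combinations of \<open>h\<close> and its convolutions, they inherit its integrability.\<close>

lemma exp_conv2_profile:
  assumes c: "c \<noteq> 0" and d: "d \<noteq> 0" and h: "nonneg_Cb h" and \<theta>: "1 < \<theta>"
    and int: "integrable lborel (\<lambda>t. h t powr \<theta>)"
  obtains f' f'' where
    "\<And>t. ((\<lambda>t. \<tau> * exp_conv2 d (- c) h t) has_real_derivative f' t) (at t)"
    "\<And>t. (f' has_real_derivative f'' t) (at t)" "continuous_on UNIV f''"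
    "\<And>t. lap_log (c + d + 2) c (\<tau> * exp_conv2 d (- c) h t) (f' t) (f'' t) = - \<tau> * sgn (c * d) * h t"
    "integrable lborel (\<lambda>t. \<bar>\<tau> * exp_conv2 d (- c) h t\<bar> powr \<theta>)"
    "integrable lborel (\<lambda>t. \<bar>f' t\<bar> powr \<theta>)" "integrable lborel (\<lambda>t. \<bar>f'' t\<bar> powr \<theta>)"
    "((\<lambda>t. \<tau> * exp_conv2 d (- c) h t) \<longlongrightarrow> 0) at_top" "((\<lambda>t. \<tau> * exp_conv2 d (- c) h t) \<longlongrightarrow> 0) at_bot"
proof -
  define w where "w = exp_conv (- c) h"
  define f where "f = exp_conv d w"
  have c': "- c \<noteq> 0" using c by simp
  have f_eq: "exp_conv2 d (- c) h = f" by (simp add: exp_conv2_def f_def w_def)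
  have bw: "nonneg_Cb w" unfolding w_def by (intro exp_conv_nonneg_Cb c' h)
  have bf: "nonneg_Cb f" unfolding f_def by (intro exp_conv_nonneg_Cb d bw)
  note iw = exp_conv_Lr(1)[OF c' h \<theta> int, folded w_def]
  note if' = exp_conv_Lr(1)[OF d bw \<theta> iw, folded f_def]
  have dw: "(w has_real_derivative c * w t + - sgn c * h t) (at t)" for t
    using exp_conv_DERIV[OF c' h, of t] by (simp add: w_def sgn_minus algebra_simps)
  have df: "(f has_real_derivative sgn d * w t + - d * f t) (at t)" for t
    using exp_conv_DERIV[OF d bw, of t] by (simp add: f_def)
  define f1 where "f1 t = sgn d * w t + - d * f t" for t
  define f2 where "f2 t = sgn d * (c * w t + - sgn c * h t) + - d * f1 t" for t
  note m = nonneg_Cb_measurable[OF h] nonneg_Cb_measurable[OF bw] nonneg_Cb_measurable[OF bf]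
  note [measurable] = m
  note ia = integrable_abs_powr_nonneg_Cb[OF h int] integrable_abs_powr_nonneg_Cb[OF bw iw] integrable_abs_powr_nonneg_Cb[OF bf if']
  have r: "0 \<le> \<theta>" using \<theta> by simp
  have i1: "integrable lborel (\<lambda>t. \<bar>f1 t\<bar> powr \<theta>)"
    unfolding f1_def by (intro integrable_abs_powr_lincomb r m ia)
  have m1: "f1 \<in> borel_measurable borel" unfolding f1_def by measurable
  have i2: "integrable lborel (\<lambda>t. \<bar>f2 t\<bar> powr \<theta>)"
    unfolding f2_def by (intro integrable_abs_powr_lincomb r m ia m1 i1) measurable
  have cont: "continuous_on UNIV h" "continuous_on UNIV w" "continuous_on UNIV f"
    using h bw bf by (auto simp: nonneg_Cb_def)
  show thesis
  proof (rule that[of "\<lambda>t. \<tau> * f1 t" "\<lambda>t. \<tau> * f2 t"]; (unfold f_eq)?)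
    show "((\<lambda>t. \<tau> * f t) has_real_derivative \<tau> * f1 t) (at t)" for t
      unfolding f1_def by (intro DERIV_cmult df)
    show "((\<lambda>t. \<tau> * f1 t) has_real_derivative \<tau> * f2 t) (at t)" for t
      unfolding f1_def f2_def by (intro DERIV_cmult DERIV_add dw df)
    show "continuous_on UNIV (\<lambda>t. \<tau> * f2 t)"
      unfolding f2_def f1_def by (intro continuous_intros cont)
    show "lap_log (c + d + 2) c (\<tau> * f t) (\<tau> * f1 t) (\<tau> * f2 t) = - \<tau> * sgn (c * d) * h t" for t
      unfolding lap_log_def f2_def f1_def sgn_mult by (simp add: algebra_simps power2_eq_square)
    show "integrable lborel (\<lambda>t. \<bar>\<tau> * f t\<bar> powr \<theta>)" using ia by (simp add: abs_mult powr_mult)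
    show "integrable lborel (\<lambda>t. \<bar>\<tau> * f1 t\<bar> powr \<theta>)" using i1 by (simp add: abs_mult powr_mult)
    show "integrable lborel (\<lambda>t. \<bar>\<tau> * f2 t\<bar> powr \<theta>)" using i2 by (simp add: abs_mult powr_mult)
    show "((\<lambda>t. \<tau> * f t) \<longlongrightarrow> 0) at_top"
      unfolding f_def by (intro tendsto_mult_right_zero exp_conv_decay_top[OF d bw \<theta> iw])
    show "((\<lambda>t. \<tau> * f t) \<longlongrightarrow> 0) at_bot"
      unfolding f_def by (intro tendsto_mult_right_zero exp_conv_decay_bot[OF d bw \<theta> iw])
  qed
qed

lemma emden_fowler_limits:
  fixes u :: "'a::euclidean_space \<Rightarrow> real"
  assumes u: "\<And>x. x \<noteq> 0 \<Longrightarrow> u x = norm x powr (- c) * f (ln (norm x))"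
    and f: "(f \<longlongrightarrow> 0) at_top" "(f \<longlongrightarrow> 0) at_bot"
  shows "((\<lambda>x. norm x powr c * u x) \<longlongrightarrow> 0) at_infinity" "((\<lambda>x. norm x powr c * u x) \<longlongrightarrow> 0) (at 0)"
proof -
  have e: "norm x powr c * u x = f (ln (norm x))" if "x \<noteq> 0" for x
    using that by (simp add: u mult.assoc[symmetric] powr_add[symmetric])
  have "((\<lambda>x::'a. f (ln (norm x))) \<longlongrightarrow> 0) at_infinity"
    by (intro filterlim_compose[OF f(1)] filterlim_compose[OF ln_at_top] filterlim_norm_at_top)
  moreover have "\<forall>\<^sub>F x::'a in at_infinity. f (ln (norm x)) = norm x powr c * u x"
    using e by (intro eventually_mono[OF eventually_not_equal_at_infinity[of 0]]) auto
  ultimately show "((\<lambda>x. norm x powr c * u x) \<longlongrightarrow> 0) at_infinity"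
    by (rule Lim_transform_eventually)
  have "filterlim (norm :: 'a \<Rightarrow> real) (at_right 0) (at 0)"
    unfolding filterlim_at by (auto intro: tendsto_norm_zero simp: eventually_at_filter)
  then have "((\<lambda>x::'a. f (ln (norm x))) \<longlongrightarrow> 0) (at 0)"
    by (intro filterlim_compose[OF f(2)] filterlim_compose[OF ln_at_0])
  moreover have "\<forall>\<^sub>F x::'a in at 0. f (ln (norm x)) = norm x powr c * u x"
    using e by (auto simp: eventually_at_filter)
  ultimately show "((\<lambda>x. norm x powr c * u x) \<longlongrightarrow> 0) (at 0)"
    by (rule Lim_transform_eventually)
qed

text \<open>The odd power nonlinearity is compatible with a change of sign.\<close>

lemma signed_power:
  fixes y :: real
  assumes "0 \<le> y" "\<bar>\<tau>\<bar> = 1"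
  shows "\<bar>\<tau> * y\<bar> powr (r - 2) * (\<tau> * y) = \<tau> * y powr (r - 1)"
proof (cases "y = 0")
  case False
  then have "y powr (r - 1) = y powr (r - 2) * y"
    using assms powr_add[of y "r - 2" 1] by simp
  then show ?thesis using assms by (simp add: abs_mult)
qed simp

theorem theorem3p1:
  fixes a b p q :: real
  assumes "CARD('n::finite) \<ge> 2"
    and "a \<noteq> - real CARD('n)" and "b \<noteq> - real CARD('n)"
    and "p > 1" and "q > 1"
    and "1 / p + 1 / q < 1"
    and "(a + real CARD('n)) / p + (b + real CARD('n)) / q = real CARD('n) - 2"
  shows "\<exists>u v :: real ^ 'n \<Rightarrow> real.
    radial_solution a b p q u v \<and>
    (\<exists>x. x \<noteq> 0 \<and> (u x \<noteq> 0 \<or> v x \<noteq> 0)) \<and>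
    u \<in> D2_rad (p / (p - 1)) (- a / (p - 1)) \<and>
    v \<in> D2_rad (q / (q - 1)) (- b / (q - 1)) \<and>
    ((\<lambda>x. norm x powr ((b + real CARD('n)) / q) * u x) \<longlongrightarrow> 0) at_infinity \<and>
    ((\<lambda>x. norm x powr ((b + real CARD('n)) / q) * u x) \<longlongrightarrow> 0) (at 0) \<and>
    ((\<lambda>x. norm x powr ((a + real CARD('n)) / p) * v x) \<longlongrightarrow> 0) at_infinity \<and>
    ((\<lambda>x. norm x powr ((a + real CARD('n)) / p) * v x) \<longlongrightarrow> 0) (at 0)"
proof -
  define n where "n = real CARD('n)"
  define c where "c = (b + n) / q"
  define d where "d = (a + n) / p"
  have dim: "real DIM(real ^ 'n) = n" by (simp add: n_def)
  have p: "1 < p" and q: "1 < q" by fact+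
  have c: "c \<noteq> 0" and d: "d \<noteq> 0" using assms(2-5) by (auto simp: c_def d_def n_def)
  have n_eq: "n = c + d + 2" using assms(7) by (simp add: c_def d_def n_def)
  have a: "a = d * p - n" and b: "b = c * q - n" using p q by (auto simp: c_def d_def)
  have "p + q < p * q" using assms(6) p q by (simp add: field_simps)
  then have "1 < (p - 1) * (q - 1)" by (simp add: algebra_simps)
  then interpret conv_pair d "- c" p q
    using c d p q by unfold_locales auto
  obtain f g where fg: "nonneg_Cb f" "nonneg_Cb g" "0 < f 0" "integrable lborel (\<lambda>t. f t powr q)" "integrable lborel (\<lambda>t. g t powr p)"
    and f: "f = exp_conv2 d (- c) (\<lambda>t. g t powr (p - 1))"
    and g: "g = exp_conv2 c (- d) (\<lambda>t. f t powr (q - 1))"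
    by (rule exists_fixed_point[unfolded minus_minus])
  \<comment> \<open>\<open>f\<close> solves \<open>- (d/dt - c)(d/dt + d) f = \<sigma> g\<^sup>p\<^sup>-\<^sup>1\<close>; the sign is absorbed into \<open>u\<close>\<close>
  define \<sigma> where "\<sigma> = sgn (c * d)"
  have \<sigma>: "\<bar>\<sigma>\<bar> = 1" "\<sigma> * \<sigma> = 1" using c d by (auto simp: \<sigma>_def sgn_if)
  note nn = nonneg_Cb_nonneg[OF fg(1)] nonneg_Cb_nonneg[OF fg(2)]
  have \<theta>: "1 < p / (p - 1)" "1 < q / (q - 1)" using p q by auto
  have "(\<lambda>t. (g t powr (p - 1)) powr (p / (p - 1))) = (\<lambda>t. g t powr p)"
    using p by (simp add: powr_powr)
  with fg have int_g: "integrable lborel (\<lambda>t. (g t powr (p - 1)) powr (p / (p - 1)))" by simp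
  have "(\<lambda>t. (f t powr (q - 1)) powr (q / (q - 1))) = (\<lambda>t. f t powr q)"
    using q by (simp add: powr_powr)
  with fg have int_f: "integrable lborel (\<lambda>t. (f t powr (q - 1)) powr (q / (q - 1)))" by simp
  have bg: "nonneg_Cb (\<lambda>t. g t powr (p - 1))" and bf: "nonneg_Cb (\<lambda>t. f t powr (q - 1))"
    using fg p q by (auto intro!: nonneg_Cb_powr)
  obtain f1 f2 where f12: "\<And>t. ((\<lambda>t. \<sigma> * f t) has_real_derivative f1 t) (at t)"
    "\<And>t. (f1 has_real_derivative f2 t) (at t)" "continuous_on UNIV f2"
    "\<And>t. lap_log n c (\<sigma> * f t) (f1 t) (f2 t) = - \<sigma> * \<sigma> * g t powr (p - 1)"
    "integrable lborel (\<lambda>t. \<bar>\<sigma> * f t\<bar> powr (p / (p - 1)))"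
    "integrable lborel (\<lambda>t. \<bar>f1 t\<bar> powr (p / (p - 1)))" "integrable lborel (\<lambda>t. \<bar>f2 t\<bar> powr (p / (p - 1)))"
    "((\<lambda>t. \<sigma> * f t) \<longlongrightarrow> 0) at_top" "((\<lambda>t. \<sigma> * f t) \<longlongrightarrow> 0) at_bot"
    using exp_conv2_profile[OF c d bg \<theta>(1) int_g, of \<sigma>, folded f \<sigma>_def, folded n_eq] by blast
  obtain g1 g2 where g12: "\<And>t. ((\<lambda>t. 1 * g t) has_real_derivative g1 t) (at t)"
    "\<And>t. (g1 has_real_derivative g2 t) (at t)" "continuous_on UNIV g2"
    "\<And>t. lap_log n d (1 * g t) (g1 t) (g2 t) = - 1 * \<sigma> * f t powr (q - 1)"
    "integrable lborel (\<lambda>t. \<bar>1 * g t\<bar> powr (q / (q - 1)))"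
    "integrable lborel (\<lambda>t. \<bar>g1 t\<bar> powr (q / (q - 1)))" "integrable lborel (\<lambda>t. \<bar>g2 t\<bar> powr (q / (q - 1)))"
    "((\<lambda>t. 1 * g t) \<longlongrightarrow> 0) at_top" "((\<lambda>t. 1 * g t) \<longlongrightarrow> 0) at_bot"
    using exp_conv2_profile[OF d c bf \<theta>(2) int_f, of 1, folded g,
        unfolded mult.commute[of d c] add.commute[of d c], folded \<sigma>_def n_eq] by blast
  define u :: "real ^ 'n \<Rightarrow> real" where "u x = norm x powr (- c) * (\<sigma> * f (ln (norm x)))" for x
  define v :: "real ^ 'n \<Rightarrow> real" where "v x = norm x powr (- d) * (1 * g (ln (norm x)))" for x
  have lap_u: "laplacian u x = - (norm x powr (- (c + 2)) * g (ln (norm x)) powr (p - 1))" if "x \<noteq> 0" for x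
    using emden_fowler_Ck_laplacian(2)[OF f12(1-3) u_def that] \<sigma>(2)
    unfolding dim f12(4) by simp
  have lap_v: "laplacian v x = - (norm x powr (- (d + 2)) * (\<sigma> * f (ln (norm x)) powr (q - 1)))" if "x \<noteq> 0" for x
    using emden_fowler_Ck_laplacian(2)[OF g12(1-3) v_def that] unfolding dim g12(4) by simp
  have eq_u: "- laplacian u x = norm x powr a * (\<bar>v x\<bar> powr (p - 2) * v x)" if x: "x \<noteq> 0" for x
  proof -
    have "\<bar>v x\<bar> powr (p - 2) * v x = (norm x powr (- d) * g (ln (norm x))) powr (p - 1)"
      using signed_power[of "norm x powr (- d) * g (ln (norm x))" 1 p] nn by (simp add: v_def)
    also have "\<dots> = norm x powr (- d * (p - 1)) * g (ln (norm x)) powr (p - 1)"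
      using nn by (simp add: powr_mult powr_powr)
    finally have "norm x powr a * (\<bar>v x\<bar> powr (p - 2) * v x) = norm x powr (a + - d * (p - 1)) * g (ln (norm x)) powr (p - 1)"
      by (simp only: powr_add mult.assoc)
    moreover have "a + - d * (p - 1) = - (c + 2)" unfolding a n_eq by (simp add: algebra_simps)
    ultimately show ?thesis by (simp add: lap_u[OF x])
  qed
  have eq_v: "- laplacian v x = norm x powr b * (\<bar>u x\<bar> powr (q - 2) * u x)" if x: "x \<noteq> 0" for x
  proof -
    have "\<bar>u x\<bar> powr (q - 2) * u x = \<sigma> * (norm x powr (- c) * f (ln (norm x))) powr (q - 1)"
      using signed_power[of "norm x powr (- c) * f (ln (norm x))" \<sigma> q] nn \<sigma> by (simp add: u_def mult.left_commute)
    also have "\<dots> = norm x powr (- c * (q - 1)) * (\<sigma> * f (ln (norm x)) powr (q - 1))"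
      using nn by (simp add: powr_mult powr_powr)
    finally have "norm x powr b * (\<bar>u x\<bar> powr (q - 2) * u x) = norm x powr (b + - c * (q - 1)) * (\<sigma> * f (ln (norm x)) powr (q - 1))"
      by (simp only: powr_add mult.assoc)
    moreover have "b + - c * (q - 1) = - (d + 2)" unfolding b n_eq by (simp add: algebra_simps)
    ultimately show ?thesis by (simp add: lap_v[OF x])
  qed
  have "radial u" "radial v" by (simp_all add: radial_def u_def v_def)
  then have sol: "radial_solution a b p q u v"
    unfolding radial_solution_def
    using eq_u eq_v emden_fowler_Ck_laplacian(1)[OF f12(1-3) u_def] emden_fowler_Ck_laplacian(1)[OF g12(1-3) v_def]
    by blast
  obtain x :: "real ^ 'n" where x: "norm x = 1" using vector_choose_size[of 1] by auto
  \<comment> \<open>on the unit sphere \<open>ln \<bar>x\<bar> = 0\<close>, and \<open>f 0 > 0\<close>\<close>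
  then have "u x \<noteq> 0" using fg(3) \<sigma> by (auto simp: u_def)
  then have nontrivial: "\<exists>x. x \<noteq> 0 \<and> (u x \<noteq> 0 \<or> v x \<noteq> 0)" using x by (intro exI[of _ x]) auto
  have "u \<in> D2_rad (p / (p - 1)) (- a / (p - 1))"
  proof (rule D2_rad_emden_fowler[OF f12(1-3) u_def \<theta>(1) _ f12(5-7)])
    have eq: "- a = (c + 2) * p - n * (p - 1)" unfolding a n_eq by (simp add: algebra_simps)
    show "- a / (p - 1) = (c + 2) * (p / (p - 1)) - real DIM(real ^ 'n)"
      unfolding dim eq using p by (simp add: diff_divide_distrib)
  qed
  moreover have "v \<in> D2_rad (q / (q - 1)) (- b / (q - 1))"
  proof (rule D2_rad_emden_fowler[OF g12(1-3) v_def \<theta>(2) _ g12(5-7)])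
    have eq: "- b = (d + 2) * q - n * (q - 1)" unfolding b n_eq by (simp add: algebra_simps)
    show "- b / (q - 1) = (d + 2) * (q / (q - 1)) - real DIM(real ^ 'n)"
      unfolding dim eq using q by (simp add: diff_divide_distrib)
  qed
  ultimately show ?thesis
    using sol nontrivial emden_fowler_limits[OF u_def f12(8,9)] emden_fowler_limits[OF v_def g12(8,9)]
    unfolding c_def d_def n_def by blast
qed

end
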